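(* Let $G$ be a connected graph that contains no induced subgraph isomorphic to $P_2\cup P_4$ and no induced subgraph isomorphic to $C_3$. Then at least one of the following holds: (i) $G$ has a comparable pair, i.e. two nonadjacent vertices $u,v$ with $N(u)\subseteq N(v)$; (ii) $\chi(G)\le 3$; (iii) $G$ contains the Mycielski–Grötzsch graph $F_1$ as an induced subgraph, and $G$ is isomorphic to an induced subgraph of the Clebsch graph $F_2$.
   Context: All graphs are finite and simple. $P_k$ and $C_k$ denote the path and the cycle on $k$ vertices; $P_2\cup P_4$ is the disjoint union of $P_2$ and $P_4$. $N(u)$ is the set of neighbours of $u$. $\chi(G)$ is the chromatic number. The Mycielski–Grötzsch graph $F_1$ has 11 vertices $v_1,\dots,v_5,w_1,\dots,w_5,z$, where $v_1v_2v_3v_4v_5v_1$ is a 5-cycle, each $w_i$ is adjacent exactly to $v_{i-1},v_{i+1}$ (indices mod 5) and $z$, and there are no other edges. The Clebsch graph $F_2$ is the graph with vertex set $\mathbb{Z}_2^4$ in which $x\sim y$ iff $x+y\in\{e_1,e_2,e_3,e_4,(1,1,1,1)\}$ (a 5-regular triangle-free graph on 16 vertices). *)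

theory Defs
  imports
    "Graph_Theory.Pair_Digraph"
    "Graph_Theory.Digraph_Isomorphism"
    "HOL-Library.Z2"
    "HOL-Library.Product_Plus"
begin

text \<open>
  A finite simple graph is a \<^locale>\<open>pair_graph\<close>: a finite vertex set with a symmetric,
  irreflexive set of ordered pairs, each edge being present in both orientations. Connectedness,
  induced subgraphs and isomorphism are those of the Graph-Theory library; its
  connected graphs have at least one vertex.
\<close>

definition has_induced_copy :: "'b pair_pre_digraph \<Rightarrow> 'a pair_pre_digraph \<Rightarrow> bool" where
  "has_induced_copy H G \<longleftrightarrow>
    (\<exists>K. induced_subgraph K (with_proj G) \<and> digraph_iso K (with_proj H))"

definition neighbourhood :: "'a pair_pre_digraph \<Rightarrow> 'a \<Rightarrow> 'a set" where
  "neighbourhood G u = {w. (u, w) \<in> parcs G}"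

definition has_comparable_pair :: "'a pair_pre_digraph \<Rightarrow> bool" where
  "has_comparable_pair G \<longleftrightarrow>
    (\<exists>u \<in> pverts G. \<exists>v \<in> pverts G.
      u \<noteq> v \<and> (u, v) \<notin> parcs G \<and> neighbourhood G u \<subseteq> neighbourhood G v)"

definition proper_colouring :: "'a pair_pre_digraph \<Rightarrow> nat \<Rightarrow> ('a \<Rightarrow> nat) \<Rightarrow> bool" where
  "proper_colouring G k c \<longleftrightarrow>
    (\<forall>v \<in> pverts G. c v < k) \<and> (\<forall>(u, v) \<in> parcs G. c u \<noteq> c v)"

text \<open>
  The minimum below is attained for every finite loopfree graph, by an injective colouring.
\<close>

definition chromatic_number :: "'a pair_pre_digraph \<Rightarrow> nat" where
  "chromatic_number G = (LEAST k. \<exists>c. proper_colouring G k c)"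

definition path_graph :: "nat \<Rightarrow> nat pair_pre_digraph" where
  "path_graph k =
    \<lparr> pverts = {..<k},
      parcs = {(i, j). i < k \<and> j < k \<and> (j = Suc i \<or> i = Suc j)} \<rparr>"

text \<open>This is the cycle only for \<open>k \<ge> 3\<close>.\<close>

definition cycle_graph :: "nat \<Rightarrow> nat pair_pre_digraph" where
  "cycle_graph k =
    \<lparr> pverts = {..<k},
      parcs = {(i, j). i < k \<and> j < k \<and> (j = Suc i mod k \<or> i = Suc j mod k)} \<rparr>"

definition disjoint_union_graph ::
    "'a pair_pre_digraph \<Rightarrow> 'b pair_pre_digraph \<Rightarrow> ('a + 'b) pair_pre_digraph" where
  "disjoint_union_graph G H =
    \<lparr> pverts = pverts G <+> pverts H,
      parcs = map_prod Inl Inl ` parcs G \<union> map_prod Inr Inr ` parcs H \<rparr>"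

datatype mg_vertex = Mv nat | Mw nat | Mz

text \<open>
  The indices of the \<open>v\<close>- and \<open>w\<close>-vertices are residues modulo 5, represented
  by \<open>0,\<dots>,4\<close>; thus \<open>(i + 4) mod 5\<close> stands for \<open>i - 1\<close>.
\<close>

definition mycielski_groetzsch :: "mg_vertex pair_pre_digraph" where
  "mycielski_groetzsch =
    (let E = {(Mv i, Mv ((i + 1) mod 5)) | i. i < 5}
           \<union> {(Mw i, Mv ((i + 4) mod 5)) | i. i < 5}
           \<union> {(Mw i, Mv ((i + 1) mod 5)) | i. i < 5}
           \<union> {(Mw i, Mz) | i. i < 5}
     in \<lparr> pverts = Mv ` {..<5} \<union> Mw ` {..<5} \<union> {Mz}, parcs = E \<union> E\<inverse> \<rparr>)"

text \<open>The vertices are the quadruples over the two-element field, added componentwise.\<close>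

definition clebsch :: "(bit \<times> bit \<times> bit \<times> bit) pair_pre_digraph" where
  "clebsch =
    \<lparr> pverts = UNIV,
      parcs = {(x, y). x + y \<in>
        {(1, 0, 0, 0), (0, 1, 0, 0), (0, 0, 1, 0), (0, 0, 0, 1), (1, 1, 1, 1)}} \<rparr>"

end

theory Submission
  imports Defs
begin

text \<open>
  Suppose that \<open>G\<close> has no comparable pair and is not 3-colourable. For a vertex \<open>u\<close> the graph induced
  on the non-neighbours of \<open>u\<close> is not bipartite, since otherwise two colours there and a third one
  on \<open>N(u)\<close> would suffice. A shortest odd cycle in it is a \<open>C\<^sub>5\<close> or a \<open>C\<^sub>7\<close>, and a \<open>C\<^sub>7\<close> together with a
  neighbour of \<open>u\<close> yields a \<open>C\<^sub>5\<close> with a vertex \<open>z\<close> that has no neighbour on it. As \<open>z\<close> is not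
  comparable with any \<open>v\<^sub>i\<close>, it has neighbours \<open>w\<^sub>i\<close>, \<open>w\<^bsub>i+1\<^esub>\<close> attached to the cycle as in \<open>F\<^sub>1\<close>. If no choice
  of these vertices extends to three consecutive \<open>w\<^sub>i\<close>, the traces of the vertices of \<open>G\<close> on this
  configuration define a 3-colouring. Otherwise the trace of a vertex on \<open>v\<^sub>0, \<dots>, v\<^sub>4, z, w\<^sub>2, w\<^sub>3, w\<^sub>4\<close> is
  empty or that of one of the 16 vertices of the Clebsch graph, adjacency is determined by the
  traces, and the absence of comparable pairs makes the trace map injective and never empty: \<open>G\<close> is
  an induced subgraph of the Clebsch graph. Inspection of its remaining seven vertices gives \<open>F\<^sub>1\<close>
  or a 3-colouring.

  Each statement on traces is a propositional consequence of finitely many instances of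
  triangle-freeness and \<open>P\<^sub>2 \<union> P\<^sub>4\<close>-freeness; these are listed explicitly and combined by a SAT solver.
\<close>

section \<open>Induced copies from vertex maps\<close>

text \<open>The copy is the subgraph \<open>K\<close> induced on the image of \<open>f\<close>. As
  \<open>digraph_iso\<close> goes from \<open>K\<close> to \<open>H\<close>, the isomorphism is the
  inverse of \<open>f\<close>, applied to both ends of an arc.\<close>

lemma has_induced_copyI:
  assumes G: "pair_wf_digraph G" and H: "pair_wf_digraph H"
    and inj: "inj_on f (pverts H)" and into: "f ` pverts H \<subseteq> pverts G"
    and arcs: "\<And>u v. u \<in> pverts H \<Longrightarrow> v \<in> pverts H \<Longrightarrow> (f u, f v) \<in> parcs G \<longleftrightarrow> (u, v) \<in> parcs H"
  shows "has_induced_copy H G"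
proof -
  interpret G: pair_wf_digraph G by fact
  interpret H: pair_wf_digraph H by fact
  define K where "K = \<lparr> pverts = f ` pverts H, parcs = parcs G \<inter> (f ` pverts H) \<times> (f ` pverts H) \<rparr>"
  interpret K: pair_wf_digraph K
    by unfold_locales (auto simp: K_def)
  have "induced_subgraph (with_proj K) (with_proj G)"
    unfolding induced_subgraph_def subgraph_def
    using into K.wf_digraph_axioms G.wf_digraph_axioms by (auto simp: K_def)
  moreover have "digraph_iso (with_proj K) (with_proj H)"
  proof -
    let ?g = "the_inv_into (pverts H) f"
    let ?h = "\<lparr> iso_verts = ?g, iso_arcs = map_prod ?g ?g, iso_head = snd, iso_tail = fst \<rparr>"
    have g: "?g (f u) = u" if "u \<in> pverts H" for u
      using inj that by (simp add: the_inv_into_f_f)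
    have g': "?g (f u) = u" "?g (f v) = v" if "(u, v) \<in> parcs H" for u v
      using that by (simp_all add: g H.in_arcsD1[of u v] H.in_arcsD2[of u v])
    have parcs: "parcs K = map_prod f f ` parcs H"
    proof -
      have "map_prod f f ` parcs H \<subseteq> parcs K"
        using arcs H.wellformed' by (fastforce simp: K_def)
      moreover have "parcs K \<subseteq> map_prod f f ` parcs H"
        using arcs by (force simp: K_def)
      ultimately show ?thesis by blast
    qed
    have inj_g: "inj_on ?g (f ` pverts H)"
      using inj by (simp add: inj_on_the_inv_into)
    have "pre_digraph.digraph_isomorphism (with_proj K) ?h"
      unfolding pre_digraph.digraph_isomorphism_def
    proof (intro conjI)
      show "inj_on (iso_arcs ?h) (arcs (with_proj K))"
        using inj_on_subset[OF map_prod_inj_on[OF inj_g inj_g]] by (simp add: K_def)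
    qed (use inj_g K.wf_digraph_axioms in \<open>auto simp: K_def\<close>)
    moreover have "with_proj H = app_iso ?h (with_proj K)"
    proof -
      have "?g ` f ` pverts H = (\<lambda>u. u) ` pverts H"
        unfolding image_image by (rule image_cong) (simp_all add: g)
      moreover have "map_prod ?g ?g ` map_prod f f ` parcs H = (\<lambda>e. e) ` parcs H"
        unfolding image_image by (rule image_cong) (auto simp: g')
      ultimately have "?g ` pverts K = pverts H" "map_prod ?g ?g ` parcs K = parcs H"
        by (simp_all add: parcs) (simp add: K_def)
      then show ?thesis by (simp add: app_iso_def with_proj_def)
    qed
    ultimately show ?thesis unfolding digraph_iso_def by blast
  qed
  ultimately show ?thesis unfolding has_induced_copy_def by blast
qed

section \<open>Three-colourings and shortest odd cycles\<close>

text \<open>Stated for a set and a relation, so that it applies to the graph as well as to its image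
  among the Clebsch quadruples.\<close>

definition three_colourable :: "'a set \<Rightarrow> ('a \<Rightarrow> 'a \<Rightarrow> bool) \<Rightarrow> bool" where
  "three_colourable V E \<longleftrightarrow>
    (\<exists>c :: 'a \<Rightarrow> nat. (\<forall>v \<in> V. c v < 3) \<and> (\<forall>u v. E u v \<longrightarrow> c u \<noteq> c v))"

lemma three_colourableI:
  assumes "\<And>u v. E u v \<Longrightarrow> P u \<Longrightarrow> \<not> P v"
    and "\<And>u v. E u v \<Longrightarrow> \<not> P u \<Longrightarrow> Q u \<Longrightarrow> \<not> P v \<Longrightarrow> \<not> Q v"
    and "\<And>u v. E u v \<Longrightarrow> \<not> P u \<Longrightarrow> \<not> Q u \<Longrightarrow> P v \<or> Q v"
  shows "three_colourable V E"
  unfolding three_colourable_def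
  by (rule exI[of _ "\<lambda>v. if P v then 0 else if Q v then 1 else 2"]) (simp, metis assms)

text \<open>A vertex is coloured by whether a walk of even length leads to it from the root of its
  component. An edge between equal colours closes two walks of equal parity to an odd closed
  walk.\<close>

lemma two_colouring_or_odd_closed_walk:
  assumes sym: "\<And>x y. E x y \<Longrightarrow> E y x"
  obtains (colouring) c :: "'a \<Rightarrow> bool" where "\<And>x y. E x y \<Longrightarrow> c x \<noteq> c y"
    | (walk) n x where "odd n" "(E ^^ n) x x"
proof (cases "\<exists>n x. odd n \<and> (E ^^ n) x x")
  case True
  then show ?thesis using walk by blast
next
  case False
  have rev: "(E ^^ n) y x" if "(E ^^ n) x y" for n x y
    using that
  proof (induction n arbitrary: y)
    case (Suc n)
    then obtain w where "(E ^^ n) x w" "E w y" by auto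
    then show ?case using Suc.IH sym by (metis relpowp_Suc_I2)
  qed auto
  have trans: "(E ^^ (m + n)) x z" if "(E ^^ m) x y" "(E ^^ n) y z" for m n x y z
    using that by (auto simp: relpowp_add)
  \<comment> \<open>The predicate under \<open>SOME\<close> depends only on the component of
    \<open>x\<close>, so adjacent vertices receive the same root; \<open>root_eq\<close> rests on
    this.\<close>
  define root where "root x = (SOME r. \<exists>n. (E ^^ n) r x)" for x
  have root: "\<exists>n. (E ^^ n) (root x) x" for x
    unfolding root_def by (rule someI[of _ x]) (rule exI[of _ 0], simp)
  have root_eq: "root x = root y" if "E x y" for x y
  proof -
    have "(\<exists>n. (E ^^ n) r x) \<longleftrightarrow> (\<exists>n. (E ^^ n) r y)" for r
      using that sym by (metis relpowp_Suc_I)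
    then show ?thesis unfolding root_def by simp
  qed
  define c where "c x \<longleftrightarrow> (\<exists>n. even n \<and> (E ^^ n) (root x) x)" for x
  have "c x \<noteq> c y" if E: "E x y" for x y
  proof
    assume eq: "c x = c y"
    obtain m n where m: "(E ^^ m) (root x) x" and n: "(E ^^ n) (root x) y" and "even m = even n"
    proof (cases "c x")
      case True
      then show ?thesis using that eq root_eq[OF E] unfolding c_def by auto
    next
      \<comment> \<open>No even walk from the root reaches \<open>x\<close> or \<open>y\<close>, so
        the walks provided by \<open>root\<close> are both odd.\<close>
      case False
      then show ?thesis using that eq root_eq[OF E] root[of x] root[of y] unfolding c_def by metis
    qed
    have "(E ^^ (m + (1 + n))) (root x) (root x)"
      by (rule trans[OF m], rule trans[of 1 x y]) (use E rev[OF n] in auto)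
    moreover have "odd (m + (1 + n))" using \<open>even m = even n\<close> by simp
    ultimately show False using False by blast
  qed
  then show ?thesis using colouring by blast
qed

text \<open>A shortest odd closed walk has no chord: a chord splits it into two closed walks whose
  lengths differ in parity, and the odd one would be shorter. The alternative \<open>i = 0\<close>,
  \<open>j = n - 1\<close> is the closing edge.\<close>

lemma two_colouring_or_induced_odd_cycle:
  assumes sym: "\<And>x y. E x y \<Longrightarrow> E y x"
  obtains (colouring) c :: "'a \<Rightarrow> bool" where "\<And>x y. E x y \<Longrightarrow> c x \<noteq> c y"
    | (cycle) n f where "odd n" "f n = f 0" "\<And>i. i < n \<Longrightarrow> E (f i) (f (Suc i))"
      "\<And>i j. i < j \<Longrightarrow> j < n \<Longrightarrow> E (f i) (f j) \<Longrightarrow> j = Suc i \<or> i = 0 \<and> j = n - 1"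
proof (cases rule: two_colouring_or_odd_closed_walk[of E, OF sym, case_names _ colouring walk])
  case (colouring c)
  then show ?thesis using that(1) by blast
next
  case (walk n0 x0)
  define n where "n = (LEAST n. odd n \<and> (\<exists>x. (E ^^ n) x x))"
  have "odd n \<and> (\<exists>x. (E ^^ n) x x)"
    unfolding n_def by (rule LeastI[of _ n0]) (use walk in blast)
  then obtain x where n: "odd n" "(E ^^ n) x x" by blast
  have least: "n \<le> k" if "odd k" "(E ^^ k) y y" for k y
    unfolding n_def by (rule Least_le) (use that in blast)
  obtain f where f: "f 0 = x" "f n = x" "\<And>i. i < n \<Longrightarrow> E (f i) (f (Suc i))"
    using n(2) unfolding relpowp_fun_conv by blast
  have sub: "(E ^^ (j - i)) (f i) (f j)" if "i \<le> j" "j \<le> n" for i j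
    unfolding relpowp_fun_conv
    by (rule exI[of _ "\<lambda>k. f (i + k)"]) (use that f(3) in auto)
  have trans: "(E ^^ (m + n)) x z" if "(E ^^ m) x y" "(E ^^ n) y z" for m n x y z
    using that by (auto simp: relpowp_add)
  have "j = Suc i \<or> i = 0 \<and> j = n - 1" if ij: "i < j" "j < n" and E: "E (f i) (f j)" for i j
  proof (cases "odd (j - i)")
    case False
    have "(E ^^ (j - i + 1)) (f i) (f i)"
      by (rule trans[OF sub]) (use ij sym[OF E] in auto)
    then have "n \<le> j - i + 1" using least False by auto
    then show ?thesis using ij by linarith
  next
    \<comment> \<open>Here the odd closed walk runs from \<open>f j\<close> through
      \<open>f n = f 0\<close> to \<open>f i\<close> and back along the chord.\<close>
    case True
    have "(E ^^ (n - j)) (f j) x" "(E ^^ i) x (f i)"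
      using sub[of j n] sub[of 0 i] ij f(1,2) by auto
    then have "(E ^^ (n - j + i + 1)) (f j) (f j)"
      using trans E by (metis relpowp_1)
    moreover have "odd (n - j + i + 1)" using True n(1) ij by presburger
    ultimately have "n \<le> n - j + i + 1" using least by blast
    then show ?thesis using ij by linarith
  qed
  then show ?thesis using that(2)[of n f] n(1) f by auto
qed

text \<open>In a triangle-free graph these edges force an induced copy of the Mycielski-Groetzsch graph.\<close>

definition groetzsch_edges ::
    "('a \<Rightarrow> 'a \<Rightarrow> bool) \<Rightarrow> 'a \<Rightarrow> 'a \<Rightarrow> 'a \<Rightarrow> 'a \<Rightarrow> 'a \<Rightarrow> 'a \<Rightarrow> 'a \<Rightarrow> 'a \<Rightarrow> 'a \<Rightarrow> 'a \<Rightarrow> 'a \<Rightarrow> bool"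
  where
  "groetzsch_edges E v0 v1 v2 v3 v4 w0 w1 w2 w3 w4 z \<longleftrightarrow>
    E v0 v1 \<and> E v1 v2 \<and> E v2 v3 \<and> E v3 v4 \<and> E v4 v0
    \<and> E w0 v4 \<and> E w0 v1 \<and> E w1 v0 \<and> E w1 v2 \<and> E w2 v1 \<and> E w2 v3 \<and> E w3 v2 \<and> E w3 v4 \<and> E w4 v3 \<and> E w4 v0
    \<and> E w0 z \<and> E w1 z \<and> E w2 z \<and> E w3 z \<and> E w4 z"

text \<open>Addition of bits is exclusive or; this turns adjacency in the Clebsch graph into a
  propositional formula.\<close>

lemma add_of_bool_bit: "of_bool P + of_bool Q = (of_bool (P \<noteq> Q) :: bit)"
  by (cases P; cases Q) simp_all

section \<open>Triangle-free graphs without induced \<open>P_2 \<union> P_4\<close>\<close>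

text \<open>The adjacencies listed in \<open>p24\<close> force the six vertices to be distinct,
  since no two vertices of \<open>P_2 \<union> P_4\<close> have the same neighbours. Instances are
  therefore propositional in \<open>E\<close> alone.\<close>

locale p2p4_c3_free =
  fixes V :: "'a set" and E :: "'a \<Rightarrow> 'a \<Rightarrow> bool"
  assumes edge_in: "E x y \<Longrightarrow> x \<in> V"
    and comm: "E x y \<longleftrightarrow> E y x"
    and tri: "E a b \<Longrightarrow> E b c \<Longrightarrow> \<not> E a c"
    and p24: "E a b \<Longrightarrow> E c d \<Longrightarrow> E d e \<Longrightarrow> E e f \<Longrightarrow> \<not> E c e \<Longrightarrow> \<not> E c f \<Longrightarrow> \<not> E d f \<Longrightarrow>
      \<not> E a c \<Longrightarrow> \<not> E a d \<Longrightarrow> \<not> E a e \<Longrightarrow> \<not> E a f \<Longrightarrow>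
      \<not> E b c \<Longrightarrow> \<not> E b d \<Longrightarrow> \<not> E b e \<Longrightarrow> \<not> E b f \<Longrightarrow> False"
begin

lemma irrefl: "\<not> E x x"
  using tri by blast

text \<open>If \<open>c0\<close> is a neighbour of \<open>x\<close>, so is \<open>c3\<close> or
  \<open>c4\<close>: otherwise the edge \<open>c3 c4\<close> and the path \<open>c1 c0 x u\<close>
  form an induced \<open>P_2 \<union> P_4\<close>. The first disjunct gives the 5-cycle
  \<open>x c0 c1 c2 c3\<close>, which \<open>c5\<close> misses; the others are its
  rotations.\<close>

lemma c7_neighbour:
  assumes "E c0 c1" "E c1 c2" "E c2 c3" "E c3 c4" "E c4 c5" "E c5 c6" "E c6 c0"
    and "\<not> E c0 c2" "\<not> E c0 c3" "\<not> E c0 c4" "\<not> E c0 c5" "\<not> E c1 c3" "\<not> E c1 c4" "\<not> E c1 c5" "\<not> E c1 c6"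
      "\<not> E c2 c4" "\<not> E c2 c5" "\<not> E c2 c6" "\<not> E c3 c5" "\<not> E c3 c6" "\<not> E c4 c6"
    and "\<not> E u c0" "\<not> E u c1" "\<not> E u c2" "\<not> E u c3" "\<not> E u c4" "\<not> E u c5" "\<not> E u c6"
    and "E x u"
  shows "E x c0 \<and> E x c3 \<and> \<not> E x c5 \<or> E x c1 \<and> E x c4 \<and> \<not> E x c6 \<or> E x c2 \<and> E x c5 \<and> \<not> E x c0
    \<or> E x c3 \<and> E x c6 \<and> \<not> E x c1 \<or> E x c4 \<and> E x c0 \<and> \<not> E x c2 \<or> E x c5 \<and> E x c1 \<and> \<not> E x c3
    \<or> E x c6 \<and> E x c2 \<and> \<not> E x c4"
  using assms
      tri[of c0 c1 x] tri[of c3 c4 x] p24[of u x c0 c6 c5 c4] tri[of c0 c6 x]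
      p24[of c3 c4 c1 c0 x u] p24[of c4 c5 c0 c1 x u] p24[of c5 c6 c1 c2 x u]
      p24[of c0 c6 c2 c3 x u] tri[of c1 c2 x] tri[of c2 c3 x] tri[of c4 c5 x] tri[of c5 c6 x]
      p24[of c2 c3 c0 c6 x u] p24[of c0 c1 c3 c4 x u] p24[of c1 c2 c4 c5 x u] comm[of c0 x]
      comm[of c1 x] comm[of c2 x] comm[of c3 x] comm[of c4 x] comm[of c5 x] comm[of c6 x]
      comm[of u x] comm[of c1 c0] comm[of c2 c0] comm[of c3 c0] comm[of c4 c0] comm[of c5 c0]
      comm[of c6 c0] comm[of u c0] comm[of c3 c1] comm[of c4 c1] comm[of c5 c1] comm[of c6 c1]
      comm[of u c1] comm[of c5 c2] comm[of c6 c2] comm[of u c2] comm[of c6 c3] comm[of u c3]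
      comm[of c5 c4] comm[of c6 c4] comm[of u c4] comm[of c6 c5] comm[of u c5] comm[of u c6]
  by satx

text \<open>The cycle lies in \<open>V\<close> by \<open>edge_in\<close>, but \<open>z\<close> is on
  no listed edge, hence \<open>z \<in> V\<close>. Chords of the cycle are excluded by
  \<open>tri\<close>.\<close>

definition c5z :: "'a \<Rightarrow> 'a \<Rightarrow> 'a \<Rightarrow> 'a \<Rightarrow> 'a \<Rightarrow> 'a \<Rightarrow> bool" where
  "c5z v0 v1 v2 v3 v4 z \<longleftrightarrow> z \<in> V \<and> E v0 v1 \<and> E v1 v2 \<and> E v2 v3 \<and> E v3 v4 \<and> E v4 v0
    \<and> \<not> E z v0 \<and> \<not> E z v1 \<and> \<not> E z v2 \<and> \<not> E z v3 \<and> \<not> E z v4"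

text \<open>
  \<open>h8\<close> and \<open>h9\<close> are the induced subgraphs of \<open>F\<^sub>1\<close> obtained by deleting \<open>w\<^sub>0, w\<^sub>1, w\<^sub>4\<close> and \<open>w\<^sub>0, w\<^sub>1\<close>. All
  non-edges other than \<open>v\<^sub>0z\<close> in \<open>h8\<close> follow from triangle-freeness.
\<close>

definition h8 :: "'a \<Rightarrow> 'a \<Rightarrow> 'a \<Rightarrow> 'a \<Rightarrow> 'a \<Rightarrow> 'a \<Rightarrow> 'a \<Rightarrow> 'a \<Rightarrow> bool" where
  "h8 v0 v1 v2 v3 v4 z w2 w3 \<longleftrightarrow> E v0 v1 \<and> E v1 v2 \<and> E v2 v3 \<and> E v3 v4 \<and> E v0 v4
    \<and> E v1 w2 \<and> E v3 w2 \<and> E z w2 \<and> E v2 w3 \<and> E v4 w3 \<and> E z w3 \<and> \<not> E v0 z"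

definition h9 :: "'a \<Rightarrow> 'a \<Rightarrow> 'a \<Rightarrow> 'a \<Rightarrow> 'a \<Rightarrow> 'a \<Rightarrow> 'a \<Rightarrow> 'a \<Rightarrow> 'a \<Rightarrow> bool" where
  "h9 v0 v1 v2 v3 v4 z w2 w3 w4 \<longleftrightarrow> E v0 v1 \<and> E v1 v2 \<and> E v2 v3 \<and> E v3 v4 \<and> E v0 v4
    \<and> E v1 w2 \<and> E v3 w2 \<and> E z w2 \<and> E v2 w3 \<and> E v4 w3 \<and> E z w3 \<and> E v0 w4 \<and> E v3 w4 \<and> E z w4"

lemma h8_nonedges:
  assumes "h8 v0 v1 v2 v3 v4 z w2 w3"
  shows "\<not> E v0 v2" "\<not> E v0 v3" "\<not> E v0 w3" "\<not> E v0 w2" "\<not> E v1 v3" "\<not> E v1 v4" "\<not> E v1 z" "\<not> E v1 w3"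
    "\<not> E v2 v4" "\<not> E v2 z" "\<not> E v2 w2" "\<not> E v3 z" "\<not> E v3 w3" "\<not> E v4 z" "\<not> E v4 w2" "\<not> E w3 w2"
  using assms unfolding h8_def by (metis comm tri)+

lemma h9_nonedges:
  assumes "h9 v0 v1 v2 v3 v4 z w2 w3 w4"
  shows "\<not> E v0 v2" "\<not> E v0 v3" "\<not> E v0 z" "\<not> E v0 w3" "\<not> E v0 w2" "\<not> E v1 v3" "\<not> E v1 v4" "\<not> E v1 z"
    "\<not> E v1 w3" "\<not> E v1 w4" "\<not> E v2 v4" "\<not> E v2 z" "\<not> E v2 w2" "\<not> E v2 w4" "\<not> E v3 z" "\<not> E v3 w3"
    "\<not> E v4 z" "\<not> E v4 w2" "\<not> E v4 w4" "\<not> E w3 w2" "\<not> E w3 w4" "\<not> E w2 w4"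
  using assms unfolding h9_def by (metis comm tri)+

section \<open>Three-colourings around the configuration \<open>h8\<close>\<close>

text \<open>Otherwise the edge \<open>v2 v3\<close> and the path \<open>v0 x y z\<close> form an
  induced \<open>P_2 \<union> P_4\<close>: every other pair among these vertices has a common
  neighbour or is a non-edge of \<open>h8\<close>.\<close>

lemma h8_nonadjacent:
  assumes h: "h8 v0 v1 v2 v3 v4 z w2 w3"
    and "E x v0" "E x w3" "E x w2" "E y v1" "E y v4" "E y z"
  shows "\<not> E x y"
  using assms h[unfolded h8_def] h8_nonedges[OF h]
      tri[of v0 v1 y] tri[of v1 v2 y] tri[of v2 w3 x] tri[of v3 v4 y] tri[of v3 w2 x] tri[of z w3 x]
      p24[of v2 v3 v0 x y z] comm[of v0 x] comm[of v2 x] comm[of v3 x] comm[of z x] comm[of w3 x]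
      comm[of w2 x] comm[of v0 y] comm[of v1 y] comm[of v2 y] comm[of v3 y] comm[of v4 y]
      comm[of v2 v0] comm[of v3 v0]
  by satx

text \<open>The classes are \<open>N(v1)\<close>, then \<open>N(v4)\<close> with the common
  neighbours of \<open>v2\<close> and \<open>w2\<close>, then the rest. On the eight vertices they
  are \<open>v0 v2 w2 | v1 v3 w3 | v4 z\<close>. With indices modulo 5, \<open>a_i\<close> stands
  for the Clebsch point \<open>w_(i+2) + w_(i+3)\<close>, which is adjacent to \<open>v_i\<close>,
  \<open>w_(i+2)\<close> and \<open>w_(i+3)\<close>.\<close>

lemma h8_three_colourable_no_a0:
  assumes h: "h8 v0 v1 v2 v3 v4 z w2 w3"
    and no_w4: "\<And>x. \<not> (E x v0 \<and> E x v3 \<and> E x z)"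
    and no_w1: "\<And>x. \<not> (E x v0 \<and> E x v2 \<and> E x z)"
    and no_a0: "\<And>x. \<not> (E x v0 \<and> E x w3 \<and> E x w2)"
  shows "three_colourable V E"
proof -
  have *: "\<not> ((E x v1 \<and> E y v1)
    \<or> (\<not> E x v1 \<and> (E x v4 \<or> E x v2 \<and> E x w2) \<and> \<not> E y v1 \<and> (E y v4 \<or> E y v2 \<and> E y w2))
    \<or> (\<not> E x v1 \<and> \<not> (E x v4 \<or> E x v2 \<and> E x w2) \<and> \<not> E y v1 \<and> \<not> (E y v4 \<or> E y v2 \<and> E y w2)))"
    if "E x y" for x y
    using that h[unfolded h8_def] h8_nonedges[OF h]
      no_w4[of x] no_w4[of y] no_w1[of x] no_w1[of y] no_a0[of x] no_a0[of y]
      tri[of v1 x y] tri[of v4 x y] tri[of v2 x y] tri[of w2 x y] tri[of v2 v3 x] tri[of v2 v3 y]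
      p24[of x y v1 v2 w3 v4] tri[of w3 x y] p24[of x y v1 w2 v3 v4] tri[of z w2 x] tri[of z w2 y]
      p24[of x y v2 v1 v0 v4] tri[of v3 w2 x] tri[of v3 w2 y] tri[of v3 v4 x] tri[of v3 v4 y]
      p24[of x y v1 v0 v4 w3] p24[of v1 w2 v4 w3 x y] p24[of v1 w2 v4 w3 y x]
      p24[of x y v1 v2 v3 v4] p24[of v4 x v2 v1 w2 z] p24[of v4 y v2 v1 w2 z]
      p24[of z w2 v2 x v0 v4] p24[of z w2 v2 y v0 v4] p24[of x y v1 v0 v4 v3]
      p24[of z w3 v1 v0 x v3] p24[of z w3 v1 v0 y v3] p24[of v0 x v3 v2 w3 z]
      p24[of v0 y v3 v2 w3 z] p24[of z x v0 v1 v2 v3] p24[of z y v0 v1 v2 v3] tri[of v0 v4 x]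
      tri[of v0 v4 y] p24[of w2 x v0 v4 w3 v2] p24[of w2 y v0 v4 w3 v2] comm[of y x] comm[of v0 x]
      comm[of v1 x] comm[of v2 x] comm[of v3 x] comm[of v4 x] comm[of z x] comm[of w3 x]
      comm[of w2 x] comm[of v0 y] comm[of v1 y] comm[of v2 y] comm[of v3 y] comm[of v4 y]
      comm[of z y] comm[of w3 y] comm[of w2 y] comm[of v1 v0] comm[of v2 v0] comm[of z v0]
      comm[of w3 v0] comm[of w2 v0] comm[of v2 v1] comm[of v4 v1] comm[of z v1] comm[of w3 v1]
      comm[of v3 v2] comm[of v4 v2] comm[of z v2] comm[of w3 v2] comm[of w2 v2] comm[of v4 v3]
      comm[of z v3] comm[of w3 v3] comm[of w2 v3] comm[of z v4] comm[of w3 v4] comm[of w2 v4]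
      comm[of w3 z] comm[of w2 z] comm[of w2 w3]
    by satx
  show ?thesis
    by (rule three_colourableI[of E "\<lambda>x. E x v1" "\<lambda>x. E x v4 \<or> E x v2 \<and> E x w2"]) (use * in blast)+
qed

text \<open>The first class is now \<open>N(w3)\<close>, and only the part of \<open>N(v4)\<close>
  outside \<open>N(v1)\<close> enters the second. On the eight vertices the classes are
  \<open>v2 v4 z | v1 v3 w3 | v0 w2\<close>.\<close>

lemma h8_three_colourable_no_w0:
  assumes h: "h8 v0 v1 v2 v3 v4 z w2 w3"
    and no_w4: "\<And>x. \<not> (E x v0 \<and> E x v3 \<and> E x z)"
    and no_w1: "\<And>x. \<not> (E x v0 \<and> E x v2 \<and> E x z)"
    and no_w0: "\<And>x. \<not> (E x v1 \<and> E x v4 \<and> E x z)"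
  shows "three_colourable V E"
proof -
  have *: "\<not> ((E x w3 \<and> E y w3)
    \<or> (\<not> E x w3 \<and> (E x v4 \<and> \<not> E x v1 \<or> E x v2 \<and> E x w2)
      \<and> \<not> E y w3 \<and> (E y v4 \<and> \<not> E y v1 \<or> E y v2 \<and> E y w2))
    \<or> (\<not> E x w3 \<and> \<not> (E x v4 \<and> \<not> E x v1 \<or> E x v2 \<and> E x w2)
      \<and> \<not> E y w3 \<and> \<not> (E y v4 \<and> \<not> E y v1 \<or> E y v2 \<and> E y w2)))"
    if "E x y" for x y
    using that h[unfolded h8_def] h8_nonedges[OF h]
      no_w4[of x] no_w4[of y] no_w1[of x] no_w1[of y] no_w0[of x] no_w0[of y]
      tri[of w3 x y] tri[of w2 x y] tri[of v1 x y] tri[of v4 x y] tri[of v0 x y] tri[of v2 x y]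
      tri[of v1 v2 x] tri[of v1 v2 y] tri[of v1 w2 x] tri[of v1 w2 y] p24[of x y v1 v2 w3 v4]
      tri[of v2 v3 x] tri[of v2 v3 y] p24[of x y w3 v4 v3 w2] tri[of v3 v4 x] tri[of v3 v4 y]
      tri[of v3 w2 x] tri[of v3 w2 y] p24[of x y v4 w3 z w2] tri[of z w2 x] tri[of z w2 y]
      p24[of v0 x v3 v2 w3 z] p24[of v0 y v3 v2 w3 z] p24[of x y v2 w3 z w2] p24[of v4 w3 w2 v1 x y]
      p24[of v4 w3 w2 v1 y x] p24[of x y v3 w2 z w3] p24[of x y w3 v2 v3 w2] p24[of v0 v4 v2 x w2 z]
      p24[of v0 v4 v2 y w2 z] p24[of w2 x v0 v4 w3 v2] p24[of w2 y v0 v4 w3 v2]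
      p24[of z x v1 v0 v4 v3] p24[of z y v1 v0 v4 v3] p24[of z x v2 v1 v0 v4]
      p24[of z y v2 v1 v0 v4] p24[of z x v0 v1 v2 v3] p24[of z y v0 v1 v2 v3]
      p24[of v4 x v2 v1 w2 z] p24[of v4 y v2 v1 w2 z] comm[of y x] comm[of v0 x] comm[of v1 x]
      comm[of v2 x] comm[of v3 x] comm[of v4 x] comm[of z x] comm[of w3 x] comm[of w2 x]
      comm[of v0 y] comm[of v1 y] comm[of v2 y] comm[of v3 y] comm[of v4 y] comm[of z y]
      comm[of w3 y] comm[of w2 y] comm[of v1 v0] comm[of v2 v0] comm[of z v0] comm[of w2 v0]
      comm[of v2 v1] comm[of v4 v1] comm[of z v1] comm[of w3 v1] comm[of w2 v1] comm[of v3 v2]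
      comm[of v4 v2] comm[of z v2] comm[of w3 v2] comm[of w2 v2] comm[of v4 v3] comm[of z v3]
      comm[of w3 v3] comm[of z v4] comm[of w3 v4] comm[of w2 v4] comm[of w3 z] comm[of w2 z]
      comm[of w2 w3]
    by satx
  show ?thesis
    by (rule three_colourableI[of E "\<lambda>x. E x w3" "\<lambda>x. E x v4 \<and> \<not> E x v1 \<or> E x v2 \<and> E x w2"])
      (use * in blast)+
qed

text \<open>The classes are \<open>N(v4)\<close>, then \<open>N(v0)\<close> with the common
  neighbours of \<open>w2\<close> and \<open>w3\<close>, then the rest. On the ten named vertices
  they are \<open>v0 v3 w3 w0 | v1 v4 z a0 | v2 w2\<close>.\<close>

lemma h8_three_colourable_a0_w0:
  assumes h: "h8 v0 v1 v2 v3 v4 z w2 w3"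
    and a0: "E a0 v0" "E a0 w3" "E a0 w2"
    and w0: "E w0 v1" "E w0 v4" "E w0 z"
    and no_w4: "\<And>x. \<not> (E x v0 \<and> E x v3 \<and> E x z)"
    and no_w1: "\<And>x. \<not> (E x v0 \<and> E x v2 \<and> E x z)"
    and no_a2: "\<And>x. \<not> (E x v2 \<and> E x a0 \<and> E x w0)"
    and no_a3: "\<And>x. \<not> (E x v3 \<and> E x a0 \<and> E x w0)"
  shows "three_colourable V E"
proof -
  note e = h[unfolded h8_def] h8_nonedges[OF h] a0 w0
  have e': "\<not> E v1 a0" "\<not> E v2 a0" "\<not> E v3 a0" "\<not> E v4 a0" "\<not> E z a0" "\<not> E a0 w0"
    "\<not> E v0 w0" "\<not> E v2 w0" "\<not> E v3 w0" "\<not> E w3 w0" "\<not> E w2 w0"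
    using e h8_nonadjacent[OF h a0 w0] by (metis comm tri)+
  have *: "\<not> ((E x v4 \<and> E y v4)
    \<or> (\<not> E x v4 \<and> (E x v0 \<or> E x w3 \<and> E x w2) \<and> \<not> E y v4 \<and> (E y v0 \<or> E y w3 \<and> E y w2))
    \<or> (\<not> E x v4 \<and> \<not> (E x v0 \<or> E x w3 \<and> E x w2) \<and> \<not> E y v4 \<and> \<not> (E y v0 \<or> E y w3 \<and> E y w2)))"
    if "E x y" for x y
    using that e e' no_w4[of x] no_w4[of y] no_w1[of x] no_w1[of y]
      no_a2[of x] no_a2[of y] no_a3[of x] no_a3[of y]
      tri[of v4 x y] tri[of v0 x y] tri[of w3 x y] tri[of z w2 x] tri[of z w2 y] tri[of a0 x y]
      tri[of w2 x y] tri[of v3 x y] p24[of x y v0 v4 w3 v2] p24[of v2 x v0 v4 w0 z]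
      p24[of v2 y v0 v4 w0 z] tri[of v1 w0 x] tri[of v1 w0 y] tri[of v3 w2 x] tri[of v3 w2 y]
      p24[of x y v4 v0 v1 w2] tri[of w3 a0 x] tri[of w3 a0 y] p24[of v0 a0 v3 v2 x w0]
      p24[of v0 a0 v3 v2 y w0] p24[of x y v4 v0 a0 w2] p24[of w2 x v0 v4 w3 v2]
      p24[of w2 y v0 v4 w3 v2] tri[of v0 a0 x] tri[of v0 a0 y] p24[of v4 w0 w2 a0 x y]
      p24[of v4 w0 w2 a0 y x] p24[of v0 x v2 w3 z w2] p24[of v0 y v2 w3 z w2] tri[of v1 v2 x]
      tri[of v1 v2 y] p24[of v2 v3 z x v0 a0] p24[of v2 v3 z y v0 a0] p24[of z w2 v2 x v0 v4]
      p24[of z w2 v2 y v0 v4] p24[of w3 x v0 v1 w2 v3] p24[of w3 y v0 v1 w2 v3]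
      p24[of v2 v3 v0 a0 x w0] p24[of v2 v3 v0 a0 y w0] p24[of a0 x v2 v3 v4 w0]
      p24[of a0 y v2 v3 v4 w0] comm[of y x] comm[of v0 x] comm[of v1 x] comm[of v2 x] comm[of v3 x]
      comm[of v4 x] comm[of z x] comm[of w3 x] comm[of w2 x] comm[of a0 x] comm[of w0 x]
      comm[of v0 y] comm[of v1 y] comm[of v2 y] comm[of v3 y] comm[of v4 y] comm[of z y]
      comm[of w3 y] comm[of w2 y] comm[of a0 y] comm[of w0 y] comm[of v2 v0] comm[of v3 v0]
      comm[of v4 v0] comm[of z v0] comm[of w3 v0] comm[of w2 v0] comm[of a0 v0] comm[of v4 v1]
      comm[of w3 v1] comm[of w0 v1] comm[of v3 v2] comm[of v4 v2] comm[of z v2] comm[of w3 v2]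
      comm[of w2 v2] comm[of a0 v2] comm[of w3 v3] comm[of w2 v3] comm[of a0 v3] comm[of z v4]
      comm[of w2 v4] comm[of a0 v4] comm[of w0 v4] comm[of w3 z] comm[of w0 z] comm[of w2 w3]
      comm[of a0 w3] comm[of a0 w2] comm[of w0 w2] comm[of w0 a0]
    by satx
  show ?thesis
    by (rule three_colourableI[of E "\<lambda>x. E x v4" "\<lambda>x. E x v0 \<or> E x w3 \<and> E x w2"]) (use * in blast)+
qed

text \<open>
  The instances of \<open>no\<close> below locate further copies of \<open>h9\<close> in the graph, so that the three
  colourings above can be applied.
\<close>

lemma h8_imp_h9:
  assumes h: "h8 v0 v1 v2 v3 v4 z w2 w3" and no_col: "\<not> three_colourable V E"
  shows "\<exists>v0 v1 v2 v3 v4 z w2 w3 w4. h9 v0 v1 v2 v3 v4 z w2 w3 w4"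
proof (rule ccontr)
  assume "\<nexists>v0 v1 v2 v3 v4 z w2 w3 w4. h9 v0 v1 v2 v3 v4 z w2 w3 w4"
  then have no: "\<not> h9 v0 v1 v2 v3 v4 z w2 w3 w4" for v0 v1 v2 v3 v4 z w2 w3 w4
    by blast
  have no_w4: "\<not> (E x v0 \<and> E x v3 \<and> E x z)" for x
    using no[of v0 v1 v2 v3 v4 z w2 w3 x] h unfolding h8_def h9_def by (metis comm)
  have no_w1: "\<not> (E x v0 \<and> E x v2 \<and> E x z)" for x
    using no[of v0 v4 v3 v2 v1 z w3 w2 x] h unfolding h8_def h9_def by (metis comm)
  obtain a0 where a0: "E a0 v0" "E a0 w3" "E a0 w2"
    using h8_three_colourable_no_a0[OF h no_w4 no_w1] no_col by blast
  obtain w0 where w0: "E w0 v1" "E w0 v4" "E w0 z"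
    using h8_three_colourable_no_w0[OF h no_w4 no_w1] no_col by blast
  have no_a2: "\<not> (E x v2 \<and> E x a0 \<and> E x w0)" for x
    using no[of v3 v4 v0 v1 w2 x w0 a0 v2] h a0 w0 unfolding h8_def h9_def by (metis comm)
  have no_a3: "\<not> (E x v3 \<and> E x a0 \<and> E x w0)" for x
    using no[of v2 v1 v0 v4 w3 x w0 a0 v3] h a0 w0 unfolding h8_def h9_def by (metis comm)
  show False
    using h8_three_colourable_a0_w0[OF h a0 w0 no_w4 no_w1 no_a2 no_a3] no_col by blast
qed

section \<open>Five-cycles with a vertex off them\<close>

lemma exists_c5z:
  assumes u: "u \<in> V" "E u w" and no_col: "\<not> three_colourable V E"
  shows "\<exists>v0 v1 v2 v3 v4 z. c5z v0 v1 v2 v3 v4 z"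
proof -
  define M where "M x y \<longleftrightarrow> E x y \<and> \<not> E u x \<and> \<not> E u y" for x y
  have M_sym: "M x y \<Longrightarrow> M y x" for x y
    unfolding M_def using comm by blast
  show ?thesis
  proof (cases rule: two_colouring_or_induced_odd_cycle[of M, OF M_sym, case_names _ colouring cycle])
    case (colouring c)
    \<comment> \<open>\<open>N(u)\<close> is stable by triangle-freeness, and \<open>c\<close>
      colours the edges that avoid it.\<close>
    have "three_colourable V E"
      by (rule three_colourableI[of E "E u" c])
        (use colouring tri comm in \<open>unfold M_def, blast\<close>)+
    then show ?thesis using no_col by blast
  next
    case (cycle n f)
    have edge: "E (f i) (f j)" if "j = Suc i" "i < n" for i j
      using cycle(3)[of i] that unfolding M_def by simp
    have free: "\<not> E u (f i)" if "i < n" for i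
      using cycle(3)[of i] that unfolding M_def by simp
    have nonedge: "\<not> E (f i) (f j)" if "i < j" "j < n" "j \<noteq> Suc i" "i \<noteq> 0 \<or> Suc j \<noteq> n" for i j
      using cycle(4)[of i j] that free[of i] free[of j] unfolding M_def by auto
    have in_V: "f i \<in> V" if "i < n" for i
      using edge_in[OF edge[OF refl that]] .
    have "n = 1 \<or> n = 3 \<or> n = 5 \<or> n = 7 \<or> n \<ge> 9" using cycle(1) by presburger
    then consider "n = 1" | "n = 3" | "n = 5" | "n = 7" | "n \<ge> 9"
      by blast
    then show ?thesis
    proof cases
      case 1
      then show ?thesis using cycle(2) edge[of 1 0] irrefl by simp
    next
      case 2
      then show ?thesis
        using tri[OF edge[of 1 0] edge[of 2 1]] edge[of 3 2] cycle(2) comm by simp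
    next
      case 3
      then have "c5z (f 0) (f 1) (f 2) (f 3) (f 4) u"
        using u(1) edge[of 1 0] edge[of 2 1] edge[of 3 2] edge[of 4 3] edge[of 5 4] cycle(2) free
        unfolding c5z_def by simp
      then show ?thesis by blast
    next
      case 4
      have e: "E (f 0) (f 1)" "E (f 1) (f 2)" "E (f 2) (f 3)" "E (f 3) (f 4)" "E (f 4) (f 5)"
        "E (f 5) (f 6)" "E (f 6) (f 0)"
        using edge[of 1 0] edge[of 2 1] edge[of 3 2] edge[of 4 3] edge[of 5 4] edge[of 6 5]
          edge[of 7 6] cycle(2) 4 by simp_all
      have ne: "\<not> E (f 0) (f 2)" "\<not> E (f 0) (f 3)" "\<not> E (f 0) (f 4)" "\<not> E (f 0) (f 5)"
        "\<not> E (f 1) (f 3)" "\<not> E (f 1) (f 4)" "\<not> E (f 1) (f 5)" "\<not> E (f 1) (f 6)"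
        "\<not> E (f 2) (f 4)" "\<not> E (f 2) (f 5)" "\<not> E (f 2) (f 6)" "\<not> E (f 3) (f 5)"
        "\<not> E (f 3) (f 6)" "\<not> E (f 4) (f 6)"
        by (rule nonedge; simp add: 4)+
      have fr: "\<not> E u (f 0)" "\<not> E u (f 1)" "\<not> E u (f 2)" "\<not> E u (f 3)" "\<not> E u (f 4)" "\<not> E u (f 5)"
        "\<not> E u (f 6)"
        by (rule free; simp add: 4)+
      have fV: "f 0 \<in> V" "f 1 \<in> V" "f 2 \<in> V" "f 3 \<in> V" "f 4 \<in> V" "f 5 \<in> V" "f 6 \<in> V"
        by (rule in_V; simp add: 4)+
      have "E w u" using u(2) comm by blast
      note disj = c7_neighbour[OF e ne fr this]
      \<comment> \<open>\<open>w a b c d\<close> is the new 5-cycle and \<open>y\<close> the vertex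
        off it, as read off from the disjuncts of \<open>disj\<close>.\<close>
      have c5: ?thesis
        if "E w a" "E w d" "\<not> E w y" "E a b" "E b c" "E c d" "y \<in> V"
          "\<not> E y a" "\<not> E y b" "\<not> E y c" "\<not> E y d" for a b c d y
      proof -
        have "c5z w a b c d y" using that comm unfolding c5z_def by blast
        then show ?thesis by blast
      qed
      have ne': "\<not> E b a" if "\<not> E a b" for a b
        using that comm by blast
      from disj show ?thesis
        by (elim disjE conjE) (erule (2) c5, (rule e fV ne ne ne[THEN ne'])+)+
    next
      \<comment> \<open>From length 9 on, no edge joins \<open>f 0\<close>, \<open>f 1\<close> to
        the path \<open>f 3\<close>, \<open>f 4\<close>, \<open>f 5\<close>, \<open>f 6\<close>; in
        a 7-cycle \<open>f 6\<close> is next to \<open>f 0\<close>.\<close>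
      case 5
      have "E (f 0) (f 1)" "E (f 3) (f 4)" "E (f 4) (f 5)" "E (f 5) (f 6)"
        by (rule edge; use 5 in simp)+
      moreover have "\<not> E (f 3) (f 5)" "\<not> E (f 3) (f 6)" "\<not> E (f 4) (f 6)"
        "\<not> E (f 0) (f 3)" "\<not> E (f 0) (f 4)" "\<not> E (f 0) (f 5)" "\<not> E (f 0) (f 6)"
        "\<not> E (f 1) (f 3)" "\<not> E (f 1) (f 4)" "\<not> E (f 1) (f 5)" "\<not> E (f 1) (f 6)"
        by (rule nonedge; use 5 in simp)+
      ultimately show ?thesis using p24 by blast
    qed
  qed
qed

text \<open>Any four consecutive cycle vertices form a path, so against the edge \<open>z x\<close>
  one of them must be adjacent to \<open>x\<close>. Hence \<open>x\<close> has at least two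
  neighbours on the cycle, and by \<open>tri\<close> they are not consecutive.\<close>

lemma c5z_neighbour:
  assumes "c5z v0 v1 v2 v3 v4 z" "E x z"
  shows "E x v0 \<and> E x v2 \<or> E x v1 \<and> E x v3 \<or> E x v2 \<and> E x v4 \<or> E x v3 \<and> E x v0 \<or> E x v4 \<and> E x v1"
proof -
  note e = assms(1)[unfolded c5z_def]
  have ne: "\<not> E v0 v2" "\<not> E v0 v3" "\<not> E v1 v3" "\<not> E v1 v4" "\<not> E v2 v4"
    using e by (metis comm tri)+
  show ?thesis
    using assms(2) e ne
      p24[of z x v0 v1 v2 v3] tri[of v0 v1 x] tri[of v0 v4 x] tri[of v1 v2 x] tri[of v2 v3 x]
      tri[of v3 v4 x] p24[of z x v0 v4 v3 v2] p24[of z x v1 v0 v4 v3] p24[of z x v1 v2 v3 v4]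
      p24[of z x v2 v1 v0 v4] comm[of v0 x] comm[of v1 x] comm[of v2 x] comm[of v3 x] comm[of v4 x]
      comm[of z x] comm[of v1 v0] comm[of v2 v0] comm[of v4 v0] comm[of z v0] comm[of v2 v1]
      comm[of z v1] comm[of v3 v2] comm[of v4 v2] comm[of z v2] comm[of v4 v3] comm[of z v3]
      comm[of z v4]
    by satx
qed

section \<open>Consequences of the absence of comparable pairs\<close>

context
  assumes no_comparable:
    "\<And>u v. u \<in> V \<Longrightarrow> v \<in> V \<Longrightarrow> u \<noteq> v \<Longrightarrow> \<not> E u v \<Longrightarrow> \<exists>w. E u w \<and> \<not> E v w"
begin

lemma c5z_imp_h8:
  assumes c: "c5z v0 v1 v2 v3 v4 z"
  shows "\<exists>v0 v1 v2 v3 v4 z w2 w3. h8 v0 v1 v2 v3 v4 z w2 w3"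
proof -
  note e = c[unfolded c5z_def]
  \<comment> \<open>For \<open>a = v_(i-1)\<close> and \<open>b = v_(i+1)\<close>,
    \<open>B a b\<close> says that some vertex can serve as \<open>w_i\<close>.\<close>
  define B where "B a b \<longleftrightarrow> (\<exists>p. E p z \<and> E p a \<and> E p b)" for a b
  have B: "B v0 v2 \<and> v \<noteq> v0 \<and> v \<noteq> v2 \<or> B v1 v3 \<and> v \<noteq> v1 \<and> v \<noteq> v3 \<or> B v2 v4 \<and> v \<noteq> v2 \<and> v \<noteq> v4
    \<or> B v3 v0 \<and> v \<noteq> v3 \<and> v \<noteq> v0 \<or> B v4 v1 \<and> v \<noteq> v4 \<and> v \<noteq> v1"
    if v: "v \<in> {v0, v1, v2, v3, v4}" for v
  proof -
    have "v \<in> V" using v e edge_in by auto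
    moreover have "z \<noteq> v" "\<not> E z v" using v e comm by auto
    ultimately obtain p where p: "E z p" "\<not> E v p" using no_comparable[of z v] e by blast
    then show ?thesis
      using c5z_neighbour[OF c, of p] comm unfolding B_def by metis
  qed
  have ne: "v0 \<noteq> v1" "v0 \<noteq> v2" "v0 \<noteq> v3" "v0 \<noteq> v4" "v1 \<noteq> v2" "v1 \<noteq> v3" "v1 \<noteq> v4" "v2 \<noteq> v3" "v2 \<noteq> v4"
    "v3 \<noteq> v4"
    using e by (metis comm tri)+
  \<comment> \<open>If no two consecutive places \<open>w_i\<close> could be filled, all those
    filled would be among some \<open>w_i\<close> and \<open>w_(i+2)\<close>. Both of these see
    \<open>v_(i+1)\<close>, which contradicts \<open>B\<close> at that vertex.\<close>
  have pairs: "B v4 v1 \<and> B v0 v2 \<or> B v0 v2 \<and> B v1 v3 \<or> B v1 v3 \<and> B v2 v4 \<or> B v2 v4 \<and> B v3 v0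
    \<or> B v3 v0 \<and> B v4 v1"
    using B[of v0] B[of v1] B[of v2] B[of v3] B[of v4] ne by blast
  have step: ?thesis if b: "B a1 a3" "B a2 a4" and c': "c5z a0 a1 a2 a3 a4 z" for a0 a1 a2 a3 a4
  proof -
    obtain w2 w3 where "E w2 z" "E w2 a1" "E w2 a3" "E w3 z" "E w3 a2" "E w3 a4"
      using b unfolding B_def by blast
    then have "h8 a0 a1 a2 a3 a4 z w2 w3"
      using c' comm unfolding c5z_def h8_def by blast
    then show ?thesis by blast
  qed
  have rot: "c5z v1 v2 v3 v4 v0 z" "c5z v2 v3 v4 v0 v1 z" "c5z v3 v4 v0 v1 v2 z" "c5z v4 v0 v1 v2 v3 z"
    using c unfolding c5z_def by blast+
  from pairs show ?thesis
    by (elim disjE conjE) (erule (1) step, rule c rot)+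
qed

text \<open>Every neighbour of a vertex with empty trace is adjacent to \<open>v2\<close>, so that
  vertex and \<open>v2\<close> would be a comparable pair. This includes isolated vertices.\<close>

lemma h9_has_neighbour:
  assumes h: "h9 v0 v1 v2 v3 v4 z w2 w3 w4" and x: "x \<in> V"
  shows "E x v0 \<or> E x v1 \<or> E x v2 \<or> E x v3 \<or> E x v4 \<or> E x z \<or> E x w3 \<or> E x w2 \<or> E x w4"
proof (rule ccontr)
  assume none: "\<not> ?thesis"
  note e = h[unfolded h9_def] h9_nonedges[OF h]
  have *: "E y v2" if "E x y" for y
    using that none e
      tri[of v0 v1 y] tri[of v3 v4 y] tri[of z w3 y] p24[of x y v0 v4 w3 v2] tri[of v0 w4 y]
      p24[of x y v1 v2 v3 w4] tri[of v1 w2 y] p24[of x y v2 v3 w2 z] tri[of v3 w2 y]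
      p24[of x y v0 v1 v2 v3] p24[of x y v2 v1 w2 z] p24[of x y w3 v2 v3 w2] tri[of v3 w4 y]
      p24[of x y v0 w4 z w2] p24[of x y v1 v2 w3 v4] comm[of v0 y] comm[of v1 y] comm[of v3 y]
      comm[of v4 y] comm[of z y] comm[of w3 y] comm[of w2 y] comm[of w4 y] comm[of v2 v1]
      comm[of v4 v2] comm[of w3 v2] comm[of w3 v3] comm[of w3 v4] comm[of w2 z] comm[of w4 z]
      comm[of w4 w2]
    by satx
  have "v2 \<in> V" "x \<noteq> v2" using e none edge_in by blast+
  then show False using no_comparable[of x v2] x none * comm by blast
qed

text \<open>Within \<open>h9\<close> the neighbours of \<open>v3\<close> are \<open>v2\<close>,
  \<open>v4\<close>, \<open>w2\<close>, \<open>w4\<close>. Every neighbour of such an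
  \<open>x\<close> is also one of \<open>v3\<close>, so distinct \<open>x\<close> and
  \<open>v3\<close> would be a comparable pair.\<close>

lemma h9_clone_eq:
  assumes h: "h9 v0 v1 v2 v3 v4 z w2 w3 w4" and x: "E x v2" "E x v4" "E x w2" "E x w4"
  shows "x = v3"
proof (rule ccontr)
  assume "x \<noteq> v3"
  note e = h[unfolded h9_def] h9_nonedges[OF h]
  have *: "E y v3" if "E x y" for y
  proof -
    have "y \<in> V" using that edge_in comm by blast
    from h9_has_neighbour[OF h this] show ?thesis
      using that x e
      tri[of v2 x y] tri[of v4 x y] tri[of w2 x y] tri[of w4 x y] tri[of v0 v1 y]
      p24[of z y v0 v4 v3 v2] p24[of w3 y v0 w4 v3 w2] p24[of v0 y v2 v3 w2 z]
      p24[of z y v1 v2 v3 v4] p24[of v1 y v3 v4 w3 z] comm[of v2 x] comm[of v4 x] comm[of w2 x]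
      comm[of w4 x] comm[of v0 y] comm[of v1 y] comm[of v2 y] comm[of v4 y] comm[of z y]
      comm[of w3 y] comm[of w2 y] comm[of w4 y] comm[of z v0] comm[of w3 v0] comm[of z v1]
      comm[of v3 v2] comm[of v4 v2] comm[of z v2] comm[of v4 v3] comm[of z v3] comm[of w3 v3]
      comm[of w4 v3] comm[of z v4] comm[of w3 z] comm[of w2 z] comm[of w4 w2]
      by satx
  qed
  have "v3 \<in> V" "x \<in> V" "\<not> E x v3" using e x edge_in tri comm by blast+
  then show False using no_comparable[of x v3] \<open>x \<noteq> v3\<close> * comm by blast
qed

text \<open>
  In the Clebsch graph take \<open>z = 0\<close>, \<open>w\<^sub>i = e\<^bsub>i+1\<^esub>\<close> for \<open>i < 4\<close>, \<open>w\<^sub>4 = (1,1,1,1)\<close> and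
  \<open>v\<^sub>i = w\<^bsub>i-1\<^esub> + w\<^bsub>i+1\<^esub>\<close>. The formulas recover a point from its adjacencies to these nine vertices.
\<close>

definition coordinates :: "'a \<Rightarrow> 'a \<Rightarrow> 'a \<Rightarrow> 'a \<Rightarrow> 'a \<Rightarrow> 'a \<Rightarrow> 'a \<Rightarrow> 'a \<Rightarrow> 'a \<Rightarrow> 'a \<Rightarrow> bit \<times> bit \<times> bit \<times> bit"
  where
  "coordinates v0 v1 v2 v3 v4 z w2 w3 w4 x =
    (of_bool ((E x v1 \<noteq> E x v3) \<or> E x v2 \<and> E x w2),
     of_bool (E x v0 \<and> E x z \<or> E x v1 \<and> E x w3 \<or> E x v2 \<and> E x w4 \<or> \<not> E x v0 \<and> \<not> E x z \<and> \<not> E x w4),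
     of_bool ((E x w2 \<noteq> E x w4) \<or> E x v3 \<and> E x z),
     of_bool ((E x v0 \<noteq> E x v2) \<or> E x v3 \<and> E x w3 \<or> E x v4 \<and> E x w4))"

text \<open>For fixed \<open>x\<close> and \<open>y\<close> the claim is propositional in
  \<open>E x y\<close> and the adjacencies of both to the nine vertices.\<close>

lemma h9_coordinates_adjacent:
  assumes h: "h9 v0 v1 v2 v3 v4 z w2 w3 w4" and x: "x \<in> V" and y: "y \<in> V"
  shows "(coordinates v0 v1 v2 v3 v4 z w2 w3 w4 x, coordinates v0 v1 v2 v3 v4 z w2 w3 w4 y)
    \<in> parcs clebsch \<longleftrightarrow> E x y"
proof -
  note e = h[unfolded h9_def] h9_nonedges[OF h]
  \<comment> \<open>A vertex with the trace of \<open>v3\<close> is \<open>v3\<close> itself, so its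
    adjacencies are read from the trace of the other vertex.\<close>
  have cx: "E x v2 \<and> E x v4 \<and> E x w2 \<and> E x w4 \<longrightarrow> (E x y \<longleftrightarrow> E y v3)"
    using h9_clone_eq[OF h, of x] comm by blast
  have cy: "E y v2 \<and> E y v4 \<and> E y w2 \<and> E y w4 \<longrightarrow> (E x y \<longleftrightarrow> E x v3)"
    using h9_clone_eq[OF h, of y] comm by blast
  show ?thesis
    unfolding coordinates_def clebsch_def
    apply (simp only: pair_pre_digraph.simps mem_Collect_eq case_prod_conv plus_prod_def fst_conv snd_conv
        add_of_bool_bit insert_iff empty_iff prod.inject of_bool_eq_0_iff of_bool_eq_1_iff simp_thms)
    using e cx cy h9_has_neighbour[OF h x] h9_has_neighbour[OF h y]
      tri[of v0 v1 x] tri[of v0 v1 y] tri[of z w3 x] tri[of z w3 y] tri[of v2 v3 x] tri[of v2 v3 y]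
      tri[of v3 v4 x] tri[of v3 v4 y] tri[of v1 w2 x] tri[of v0 w4 x] tri[of v1 w2 y]
      tri[of v0 w4 y] tri[of v2 w3 x] tri[of z w4 x] tri[of v2 w3 y] tri[of z w4 y] tri[of z w2 x]
      tri[of z w2 y] tri[of v4 w3 x] tri[of v4 w3 y] tri[of v1 v2 x] tri[of v3 w2 x] tri[of v0 v4 x]
      tri[of v1 v2 y] tri[of v3 w2 y] tri[of v0 v4 y] tri[of v3 w4 x] tri[of v3 w4 y] tri[of w2 x y]
      tri[of w4 x y] tri[of v4 x y] tri[of v0 x y] tri[of v1 x y] p24[of z x v2 v1 v0 v4]
      p24[of w3 x w2 v1 v0 w4] tri[of v2 x y] p24[of z y v2 v1 v0 v4] p24[of w3 y w2 v1 v0 w4]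
      p24[of v0 x v2 v3 w2 z] p24[of v0 y v2 v3 w2 z] p24[of v1 x v4 w3 z w4]
      p24[of v1 y v4 w3 z w4] p24[of v2 x v0 w4 z w2] p24[of v2 y v0 w4 z w2]
      p24[of w4 x w3 v2 v1 w2] p24[of w4 y w3 v2 v1 w2] tri[of z x y] p24[of w2 x w3 v4 v0 w4]
      p24[of w2 y w3 v4 v0 w4] tri[of w3 x y] p24[of v2 w3 v0 w4 x w2] p24[of v2 w3 v0 w4 y w2]
      tri[of v3 x y] p24[of v4 x v1 w2 z w4] p24[of v4 y v1 w2 z w4] p24[of z x v0 v1 v2 v3]
      p24[of z y v0 v1 v2 v3] p24[of w3 x v0 v1 w2 v3] p24[of w3 y v0 v1 w2 v3]
      p24[of v1 x v3 v4 w3 z] p24[of v1 y v3 v4 w3 z] p24[of w3 x v0 w4 v3 w2]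
      p24[of w3 y v0 w4 v3 w2] p24[of z w4 v2 v1 x v4] p24[of z w4 v2 v1 y v4]
      p24[of w3 x v1 v0 w4 v3] p24[of w3 y v1 v0 w4 v3] p24[of z w4 v1 v2 x v4]
      p24[of z w4 v1 v2 y v4] p24[of z x v1 v2 v3 v4] p24[of z y v1 v2 v3 v4]
      p24[of z w2 v2 x v0 v4] p24[of z w2 v2 y v0 v4] p24[of z x v0 v4 v3 v2]
      p24[of z y v0 v4 v3 v2] p24[of z w2 v0 v4 x v2] p24[of z w2 v0 v4 y v2]
      p24[of z x v1 v0 v4 v3] p24[of z y v1 v0 v4 v3] p24[of z w3 v1 v0 x v3]
      p24[of z w3 v1 v0 y v3] p24[of v0 x v3 v2 w3 z] p24[of v0 y v3 v2 w3 z]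
      p24[of v4 w3 v1 w2 x w4] p24[of v4 w3 v1 w2 y w4] p24[of x y v0 v1 v2 w3]
      p24[of x y v0 v1 w2 z] p24[of x y v2 v1 v0 v4] p24[of x y v2 w3 z w2] p24[of x y v4 w3 z w4]
      p24[of x y w2 v1 v0 w4] p24[of z y v0 v1 x v3] p24[of w3 y v0 v1 x v3] p24[of v3 y v0 v1 x z]
      p24[of v3 y v0 v1 x w3] p24[of z x v0 v1 y v3] p24[of w3 x v0 v1 y v3] p24[of v3 x v0 v1 y z]
      p24[of v3 x v0 v1 y w3] p24[of w2 y v0 v4 x v2] p24[of v2 y v0 v4 x z] p24[of v2 y v0 v4 x w2]
      p24[of w2 x v0 v4 y v2] p24[of v2 x v0 v4 y z] p24[of v2 x v0 v4 y w2] p24[of w2 y v0 w4 x w3]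
      p24[of w2 x v0 w4 y w3] p24[of z y v0 x v2 v3] p24[of w2 y v0 x v2 w3] p24[of z y v0 x v3 v2]
      p24[of w3 y v0 x v3 w2] p24[of v3 y v0 x z w3] p24[of v2 y v0 x z w2] p24[of w2 y v0 x w3 v2]
      p24[of v3 y v0 x w3 z] p24[of w3 y v0 x w2 v3] p24[of v2 y v0 x w2 z] p24[of z w2 v0 x y v2]
      p24[of v2 v3 v0 x y z] p24[of v3 w2 v0 x y w3] p24[of v2 w3 v0 x y w2] p24[of z x v0 y v2 v3]
      p24[of w2 x v0 y v2 w3] p24[of z x v0 y v3 v2] p24[of w3 x v0 y v3 w2] p24[of v3 x v0 y z w3]
      p24[of v2 x v0 y z w2] p24[of w2 x v0 y w3 v2] p24[of v3 x v0 y w3 z] p24[of w3 x v0 y w2 v3]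
      p24[of v2 x v0 y w2 z] p24[of z w2 v0 y x v2] p24[of v2 v3 v0 y x z] p24[of v3 w2 v0 y x w3]
      p24[of v2 w3 v0 y x w2] p24[of z y v1 v0 x v3] p24[of w3 y v1 v0 x v3] p24[of z x v1 v0 y v3]
      p24[of w3 x v1 v0 y v3] p24[of z y v1 x v3 v4] p24[of w3 y v1 x v3 w4] p24[of z y v1 x v4 v3]
      p24[of v4 y v1 x z w4] p24[of w4 y v1 x w3 v4] p24[of w3 y v1 x w4 v3] p24[of z w4 v1 x y v4]
      p24[of v4 w3 v1 x y w4] p24[of z x v1 y v3 v4] p24[of w3 x v1 y v3 w4] p24[of z x v1 y v4 v3]
      p24[of v4 x v1 y z w4] p24[of w4 x v1 y w3 v4] p24[of w3 x v1 y w4 v3] p24[of z w4 v1 y x v4]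
      p24[of v4 w3 v1 y x w4] p24[of z y v2 v1 x v4] p24[of w4 y v2 v1 x v4] p24[of z x v2 v1 y v4]
      p24[of w4 x v2 v1 y v4] p24[of z y v2 x v0 v4] p24[of w2 y v2 x v0 v4] p24[of v4 y v2 x w2 z]
      p24[of z x v2 y v0 v4] p24[of w2 x v2 y v0 v4] p24[of v4 x v2 y w2 z] p24[of v0 y v3 v2 x z]
      p24[of v0 x v3 v2 y z] p24[of v1 y v3 v4 x z] p24[of v1 x v3 v4 y z] p24[of v0 y v3 x w3 z]
      p24[of v1 y v3 x w3 z] p24[of v0 x v3 y w3 z] p24[of v1 x v3 y w3 z] comm[of y x]
      comm[of v0 x] comm[of v1 x] comm[of v2 x] comm[of v3 x] comm[of v4 x] comm[of z x]
      comm[of w3 x] comm[of w2 x] comm[of w4 x] comm[of v0 y] comm[of v1 y] comm[of v2 y]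
      comm[of v3 y] comm[of v4 y] comm[of z y] comm[of w3 y] comm[of w2 y] comm[of w4 y]
      comm[of v1 v0] comm[of v2 v0] comm[of v3 v0] comm[of v4 v0] comm[of z v0] comm[of w3 v0]
      comm[of w2 v0] comm[of v2 v1] comm[of v3 v1] comm[of v4 v1] comm[of z v1] comm[of w3 v1]
      comm[of w2 v1] comm[of w4 v1] comm[of v3 v2] comm[of v4 v2] comm[of z v2] comm[of w3 v2]
      comm[of w2 v2] comm[of w4 v2] comm[of v4 v3] comm[of z v3] comm[of w3 v3] comm[of w2 v3]
      comm[of w4 v3] comm[of z v4] comm[of w3 v4] comm[of w2 v4] comm[of w4 v4] comm[of w3 z]
      comm[of w2 z] comm[of w4 z] comm[of w2 w3] comm[of w4 w3] comm[of w4 w2]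
    by satx
qed

text \<open>Vertices with equal coordinates have equal neighbourhoods and would be a comparable pair
  if distinct. The nine quadruples are the images of
  \<open>z, w2, w3, w4, v0, v1, v2, v3, v4\<close>, in this order.\<close>

lemma h9_imp_clebsch:
  assumes h: "h9 v0 v1 v2 v3 v4 z w2 w3 w4"
  obtains \<tau> where "inj_on \<tau> V" "\<And>x y. x \<in> V \<Longrightarrow> y \<in> V \<Longrightarrow> (\<tau> x, \<tau> y) \<in> parcs clebsch \<longleftrightarrow> E x y"
    "{(0, 0, 0, 0), (0, 0, 1, 0), (0, 0, 0, 1), (1, 1, 1, 1), (1, 0, 1, 1), (1, 0, 1, 0), (0, 1, 0, 1), (1, 1, 0, 1), (1, 0, 0, 1)} \<subseteq> \<tau> ` V"
proof -
  let ?\<tau> = "coordinates v0 v1 v2 v3 v4 z w2 w3 w4"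
  note adj = h9_coordinates_adjacent[OF h]
  note e = h[unfolded h9_def] h9_nonedges[OF h]
  have "x = y" if "x \<in> V" "y \<in> V" "?\<tau> x = ?\<tau> y" for x y
  proof (rule ccontr)
    assume "x \<noteq> y"
    have eq: "E x w \<longleftrightarrow> E y w" for w
      using adj[of x w] adj[of y w] that edge_in comm by metis
    then have "\<not> E x y" using irrefl by blast
    then show False using no_comparable[OF that(1,2) \<open>x \<noteq> y\<close>] eq by blast
  qed
  moreover have "{(0, 0, 0, 0), (0, 0, 1, 0), (0, 0, 0, 1), (1, 1, 1, 1), (1, 0, 1, 1), (1, 0, 1, 0), (0, 1, 0, 1), (1, 1, 0, 1), (1, 0, 0, 1)} \<subseteq> ?\<tau> ` V"
  proof -
    have "{z, w2, w3, w4, v0, v1, v2, v3, v4} \<subseteq> V" using e edge_in comm by blast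
    moreover have "?\<tau> ` {z, w2, w3, w4, v0, v1, v2, v3, v4} = {(0, 0, 0, 0), (0, 0, 1, 0), (0, 0, 0, 1), (1, 1, 1, 1), (1, 0, 1, 1), (1, 0, 1, 0), (0, 1, 0, 1), (1, 1, 0, 1), (1, 0, 0, 1)}"
      using e by (simp add: coordinates_def comm irrefl)
    ultimately show ?thesis by (metis image_mono)
  qed
  ultimately show ?thesis using that[of ?\<tau>] adj by (simp add: inj_on_def)
qed

end

end

section \<open>Induced subgraphs of the Clebsch graph that contain the nine points\<close>

lemma subset_bit4_iff:
  fixes S X :: "(bit \<times> bit \<times> bit \<times> bit) set"
  shows "S \<subseteq> X \<longleftrightarrow> (\<forall>p \<in> {(0, 0, 0, 0), (0, 0, 0, 1), (0, 0, 1, 0), (0, 0, 1, 1), (0, 1, 0, 0), (0, 1, 0, 1), (0, 1, 1, 0), (0, 1, 1, 1), (1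
    , 0, 0, 0), (1, 0, 0, 1), (1, 0, 1, 0), (1, 0, 1, 1), (1, 1, 0, 0), (1, 1, 0, 1), (1, 1, 1, 0), (1, 1, 1, 1)}. p \<in> S \<longrightarrow> p \<in> X)"
proof -
  have mem: "p \<in> {(0, 0, 0, 0), (0, 0, 0, 1), (0, 0, 1, 0), (0, 0, 1, 1), (0, 1, 0, 0), (0, 1, 0, 1), (0, 1, 1, 0), (0, 1, 1, 1), (1
    , 0, 0, 0), (1, 0, 0, 1), (1, 0, 1, 0), (1, 0, 1, 1), (1, 1, 0, 0), (1, 1, 0, 1), (1, 1, 1, 0), (1, 1, 1, 1)}" for p :: "bit \<times> bit \<times> bit \<times> bit"
  proof -
    obtain a b c d where "p = (a, b, c, d)" by (cases p)
    then show ?thesis by (cases a; cases b; cases c; cases d; simp)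
  qed
  show ?thesis
    unfolding subset_iff Ball_def by (simp only: mem simp_thms)
qed

text \<open>Seven points are undecided: \<open>w0 = (1,0,0,0)\<close>, \<open>w1 = (0,1,0,0)\<close>
  and, for \<open>i = 0, ..., 4\<close>, the points \<open>a_i = w_(i+2) + w_(i+3)\<close>, that is
  \<open>(0,0,1,1)\<close>, \<open>(1,1,1,0)\<close>, \<open>(0,1,1,1)\<close>,
  \<open>(1,1,0,0)\<close>, \<open>(0,1,1,0)\<close>. Finitely many facts on their presence and
  absence contradict each other.\<close>

lemma clebsch_induced_three_colourable_or_groetzsch:
  fixes S :: "(bit \<times> bit \<times> bit \<times> bit) set"
  defines "R \<equiv> \<lambda>p q. p \<in> S \<and> q \<in> S \<and> (p, q) \<in> parcs clebsch"
  assumes K: "{(0, 0, 0, 0), (0, 0, 1, 0), (0, 0, 0, 1), (1, 1, 1, 1), (1, 0, 1, 1), (1, 0, 1, 0), (0, 1, 0, 1), (1, 1, 0, 1), (1, 0, 0, 1)} \<subseteq> S"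
    and no_col: "\<not> three_colourable S R"
  shows "\<exists>v0 v1 v2 v3 v4 w0 w1 w2 w3 w4 z. groetzsch_edges R v0 v1 v2 v3 v4 w0 w1 w2 w3 w4 z"
proof (rule ccontr)
  assume "\<not> ?thesis"
  then have no: "\<not> groetzsch_edges R v0 v1 v2 v3 v4 w0 w1 w2 w3 w4 z"
    for v0 v1 v2 v3 v4 w0 w1 w2 w3 w4 z
    by blast
  have three_stable: "three_colourable S R"
    if cover: "S \<subseteq> A \<union> B \<union> C" and stable: "\<forall>p \<in> A. \<forall>q \<in> A. (p, q) \<notin> parcs clebsch"
      "\<forall>p \<in> B. \<forall>q \<in> B. (p, q) \<notin> parcs clebsch" "\<forall>p \<in> C. \<forall>q \<in> C. (p, q) \<notin> parcs clebsch"
    for A B C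
  proof (rule three_colourableI[of R "\<lambda>p. p \<in> A" "\<lambda>p. p \<in> B"])
    fix u v assume "R u v"
    then have uv: "u \<in> A \<union> B \<union> C" "v \<in> A \<union> B \<union> C" "(u, v) \<in> parcs clebsch"
      using cover by (auto simp: R_def)
    show "v \<notin> A" if "u \<in> A" using that stable(1) uv(3) by blast
    show "v \<notin> B" if "u \<in> B" using that stable(2) uv(3) by blast
    show "v \<in> A \<or> v \<in> B" if "u \<notin> A" "u \<notin> B" using that stable(3) uv by blast
  qed
  \<comment> \<open>In \<open>f1\<close> to \<open>f8\<close> the named points and some of the nine
    fixed ones form a copy of \<open>F_1\<close>. These clauses, like \<open>c1\<close> to
    \<open>c8\<close>, are closed under the reflection \<open>i \<mapsto> 1 - i\<close> of the
    indices modulo 5.\<close>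
  have f1: "\<not> ((0, 1, 0, 0) \<in> S \<and> (1, 0, 0, 0) \<in> S)"
    using K no[of "(1, 0, 0, 1)" "(1, 0, 1, 1)" "(1, 0, 1, 0)" "(0, 1, 0, 1)" "(1, 1, 0, 1)" "(1, 1, 1, 1)" "(1, 0, 0, 0)" "(0, 1, 0, 0)" "(0, 0, 1, 0)" "(0, 0, 0, 1)" "(0, 0, 0, 0)"]
    by (simp add: groetzsch_edges_def R_def clebsch_def zero_prod_def; blast)
  have f2: "\<not> ((0, 1, 0, 0) \<in> S \<and> (0, 0, 1, 1) \<in> S)"
    using K no[of "(0, 0, 1, 0)" "(1, 1, 0, 1)" "(0, 1, 0, 1)" "(0, 0, 0, 1)" "(0, 0, 0, 0)" "(1, 1, 1, 1)" "(1, 0, 1, 0)" "(1, 0, 0, 1)" "(0, 1, 0, 0)" "(0, 0, 1, 1)" "(1, 0, 1, 1)"]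
    by (simp add: groetzsch_edges_def R_def clebsch_def zero_prod_def; blast)
  have f3: "\<not> ((1, 1, 0, 0) \<in> S \<and> (1, 0, 0, 0) \<in> S \<and> (0, 0, 1, 1) \<in> S \<and> (0, 1, 1, 1) \<in> S)"
    using K no[of "(1, 1, 1, 1)" "(1, 0, 1, 1)" "(0, 0, 1, 1)" "(0, 0, 1, 0)" "(1, 1, 0, 1)" "(1, 0, 0, 1)" "(0, 1, 1, 1)" "(1, 0, 1, 0)" "(1, 1, 0, 0)" "(0, 0, 0, 0)" "(1, 0, 0, 0)"]
    by (simp add: groetzsch_edges_def R_def clebsch_def zero_prod_def; blast)
  have f4: "\<not> ((1, 0, 0, 0) \<in> S \<and> (0, 1, 1, 0) \<in> S \<and> (0, 0, 1, 1) \<in> S \<and> (0, 1, 1, 1) \<in> S)"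
    using K no[of "(1, 1, 1, 1)" "(0, 1, 1, 1)" "(1, 0, 0, 0)" "(1, 0, 0, 1)" "(1, 0, 1, 1)" "(0, 0, 1, 1)" "(0, 0, 0, 0)" "(0, 1, 1, 0)" "(1, 0, 1, 0)" "(1, 1, 0, 1)" "(0, 0, 1, 0)"]
    by (simp add: groetzsch_edges_def R_def clebsch_def zero_prod_def; blast)
  have f5: "\<not> ((1, 0, 0, 0) \<in> S \<and> (1, 1, 1, 0) \<in> S)"
    using K no[of "(1, 1, 1, 1)" "(1, 1, 0, 1)" "(1, 0, 0, 1)" "(0, 0, 0, 1)" "(0, 0, 0, 0)" "(0, 0, 1, 0)" "(1, 0, 1, 1)" "(0, 1, 0, 1)" "(1, 0, 0, 0)" "(1, 1, 1, 0)" "(1, 0, 1, 0)"]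
    by (simp add: groetzsch_edges_def R_def clebsch_def zero_prod_def; blast)
  have f6: "\<not> ((1, 1, 0, 0) \<in> S \<and> (0, 1, 0, 0) \<in> S \<and> (0, 1, 1, 0) \<in> S \<and> (1, 1, 1, 0) \<in> S)"
    using K no[of "(0, 1, 0, 0)" "(0, 1, 0, 1)" "(1, 1, 0, 1)" "(0, 0, 1, 0)" "(0, 0, 0, 0)" "(0, 0, 0, 1)" "(1, 1, 0, 0)" "(1, 0, 1, 0)" "(1, 1, 1, 1)" "(0, 1, 1, 0)" "(1, 1, 1, 0)"]
    by (simp add: groetzsch_edges_def R_def clebsch_def zero_prod_def; blast)
  have f7: "\<not> ((0, 0, 1, 1) \<in> S \<and> (1, 1, 1, 0) \<in> S)"
    using K no[of "(1, 1, 1, 1)" "(1, 0, 1, 1)" "(1, 0, 1, 0)" "(0, 0, 1, 0)" "(1, 1, 0, 1)" "(1, 0, 0, 1)" "(1, 1, 1, 0)" "(0, 0, 1, 1)" "(0, 1, 0, 1)" "(0, 0, 0, 0)" "(0, 0, 0, 1)"]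
    by (simp add: groetzsch_edges_def R_def clebsch_def zero_prod_def; blast)
  have f8: "\<not> ((0, 1, 0, 0) \<in> S \<and> (0, 1, 1, 0) \<in> S \<and> (0, 1, 1, 1) \<in> S \<and> (1, 1, 1, 0) \<in> S)"
    using K no[of "(0, 1, 0, 0)" "(0, 1, 0, 1)" "(0, 0, 0, 1)" "(1, 0, 0, 1)" "(0, 1, 1, 0)" "(0, 1, 1, 1)" "(0, 0, 0, 0)" "(1, 1, 0, 1)" "(1, 1, 1, 0)" "(1, 0, 1, 1)" "(1, 1, 1, 1)"]
    by (simp add: groetzsch_edges_def R_def clebsch_def zero_prod_def; blast)
  \<comment> \<open>In \<open>c1\<close> to \<open>c8\<close>, deleting the named points leaves a
    union of three stable sets.\<close>
  have c1: "(0, 1, 0, 0) \<in> S \<or> (0, 1, 1, 1) \<in> S \<or> (1, 1, 1, 0) \<in> S"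
  proof (rule ccontr)
    assume "\<not> ?thesis"
    then have "S \<subseteq> {(1, 1, 0, 0), (1, 1, 1, 1), (0, 0, 1, 0), (1, 0, 0, 1), (0, 1, 0, 1)}
      \<union> {(1, 0, 0, 0), (0, 0, 0, 1), (0, 1, 1, 0), (1, 0, 1, 1), (1, 1, 0, 1)}
      \<union> {(1, 0, 1, 0), (0, 0, 1, 1), (0, 0, 0, 0)}"
      unfolding subset_bit4_iff by simp
    then have "three_colourable S R"
      by (rule three_stable) (simp_all add: clebsch_def zero_prod_def)
    then show False using no_col by blast
  qed
  have c2: "(1, 0, 0, 0) \<in> S \<or> (0, 0, 1, 1) \<in> S \<or> (1, 1, 1, 0) \<in> S"
  proof (rule ccontr)
    assume "\<not> ?thesis"
    then have "S \<subseteq> {(1, 1, 0, 0), (1, 1, 1, 1), (0, 0, 1, 0), (1, 0, 0, 1), (0, 1, 0, 1)}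
      \<union> {(0, 1, 0, 0), (0, 0, 0, 1), (1, 0, 1, 0), (0, 1, 1, 1), (1, 1, 0, 1)}
      \<union> {(0, 1, 1, 0), (1, 0, 1, 1), (0, 0, 0, 0)}"
      unfolding subset_bit4_iff by simp
    then have "three_colourable S R"
      by (rule three_stable) (simp_all add: clebsch_def zero_prod_def)
    then show False using no_col by blast
  qed
  have c3: "(0, 1, 0, 0) \<in> S \<or> (0, 0, 1, 1) \<in> S \<or> (1, 1, 1, 0) \<in> S"
  proof (rule ccontr)
    assume "\<not> ?thesis"
    then have "S \<subseteq> {(1, 1, 0, 0), (1, 1, 1, 1), (0, 0, 1, 0), (1, 0, 0, 1), (0, 1, 0, 1)}
      \<union> {(1, 0, 0, 0), (0, 0, 0, 1), (0, 1, 1, 0), (1, 0, 1, 1), (1, 1, 0, 1)}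
      \<union> {(1, 0, 1, 0), (0, 1, 1, 1), (0, 0, 0, 0)}"
      unfolding subset_bit4_iff by simp
    then have "three_colourable S R"
      by (rule three_stable) (simp_all add: clebsch_def zero_prod_def)
    then show False using no_col by blast
  qed
  have c4: "(1, 1, 0, 0) \<in> S \<or> (0, 1, 0, 0) \<in> S \<or> (0, 1, 1, 0) \<in> S \<or> (1, 1, 1, 0) \<in> S"
  proof (rule ccontr)
    assume "\<not> ?thesis"
    then have "S \<subseteq> {(1, 1, 1, 1), (0, 0, 1, 0), (1, 0, 0, 0), (0, 1, 0, 1)}
      \<union> {(0, 0, 0, 1), (0, 1, 1, 1), (1, 0, 1, 1), (1, 1, 0, 1)}
      \<union> {(1, 0, 0, 1), (1, 0, 1, 0), (0, 0, 1, 1), (0, 0, 0, 0)}"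
      unfolding subset_bit4_iff by simp
    then have "three_colourable S R"
      by (rule three_stable) (simp_all add: clebsch_def zero_prod_def)
    then show False using no_col by blast
  qed
  have c5: "(0, 1, 0, 0) \<in> S \<or> (1, 0, 0, 0) \<in> S \<or> (1, 1, 1, 0) \<in> S"
  proof (rule ccontr)
    assume "\<not> ?thesis"
    then have "S \<subseteq> {(1, 1, 0, 0), (1, 1, 1, 1), (0, 0, 1, 0), (1, 0, 0, 1), (0, 1, 0, 1)}
      \<union> {(0, 0, 0, 1), (0, 1, 1, 1), (1, 0, 1, 1), (1, 1, 0, 1)}
      \<union> {(1, 0, 1, 0), (0, 1, 1, 0), (0, 0, 1, 1), (0, 0, 0, 0)}"
      unfolding subset_bit4_iff by simp
    then have "three_colourable S R"
      by (rule three_stable) (simp_all add: clebsch_def zero_prod_def)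
    then show False using no_col by blast
  qed
  have c6: "(1, 1, 0, 0) \<in> S \<or> (1, 0, 0, 0) \<in> S \<or> (0, 0, 1, 1) \<in> S \<or> (0, 1, 1, 1) \<in> S"
  proof (rule ccontr)
    assume "\<not> ?thesis"
    then have "S \<subseteq> {(0, 1, 0, 0), (1, 1, 1, 1), (0, 0, 1, 0), (1, 0, 0, 1)}
      \<union> {(0, 0, 0, 1), (1, 0, 1, 0), (0, 1, 1, 0), (1, 1, 0, 1)}
      \<union> {(0, 1, 0, 1), (1, 0, 1, 1), (1, 1, 1, 0), (0, 0, 0, 0)}"
      unfolding subset_bit4_iff by simp
    then have "three_colourable S R"
      by (rule three_stable) (simp_all add: clebsch_def zero_prod_def)
    then show False using no_col by blast
  qed
  have c7: "(1, 0, 0, 0) \<in> S \<or> (0, 1, 1, 0) \<in> S \<or> (0, 0, 1, 1) \<in> S"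
  proof (rule ccontr)
    assume "\<not> ?thesis"
    then have "S \<subseteq> {(1, 1, 0, 0), (1, 1, 1, 1), (0, 0, 1, 0), (1, 0, 0, 1), (0, 1, 0, 1)}
      \<union> {(0, 1, 0, 0), (0, 0, 0, 1), (1, 0, 1, 0), (0, 1, 1, 1), (1, 1, 0, 1)}
      \<union> {(1, 0, 1, 1), (1, 1, 1, 0), (0, 0, 0, 0)}"
      unfolding subset_bit4_iff by simp
    then have "three_colourable S R"
      by (rule three_stable) (simp_all add: clebsch_def zero_prod_def)
    then show False using no_col by blast
  qed
  have c8: "(0, 1, 0, 0) \<in> S \<or> (1, 0, 0, 0) \<in> S \<or> (0, 0, 1, 1) \<in> S"
  proof (rule ccontr)
    assume "\<not> ?thesis"
    then have "S \<subseteq> {(1, 1, 0, 0), (1, 1, 1, 1), (0, 0, 1, 0), (1, 0, 0, 1), (0, 1, 0, 1)}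
      \<union> {(0, 0, 0, 1), (1, 0, 1, 0), (0, 1, 1, 0), (1, 1, 0, 1)}
      \<union> {(0, 1, 1, 1), (1, 0, 1, 1), (1, 1, 1, 0), (0, 0, 0, 0)}"
      unfolding subset_bit4_iff by simp
    then have "three_colourable S R"
      by (rule three_stable) (simp_all add: clebsch_def zero_prod_def)
    then show False using no_col by blast
  qed
  \<comment> \<open>By \<open>f1 f2 f5 f7\<close> and \<open>c2 c3 c5 c8\<close>, exactly two of
    \<open>w0, w1, a_0, a_1\<close> are present, namely \<open>w0, a_0\<close> or
    \<open>w1, a_1\<close>. In the first case \<open>c1\<close> gives \<open>a_2\<close>, then
    \<open>f3\<close> and \<open>f4\<close> exclude \<open>a_3\<close> and \<open>a_4\<close>,
    against \<open>c4\<close>. The second case is its mirror image.\<close>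
  from f1 f2 f3 f4 f5 f6 f7 f8 c1 c2 c3 c4 c5 c6 c7 c8 show False
    by satx
qed

section \<open>The Clebsch embedding and the copy of \<open>F_1\<close>\<close>

context p2p4_c3_free
begin

text \<open>As \<open>\<tau>\<close> is an isomorphism onto its image, a 3-colouring of the image
  pulls back to one of the graph, and a copy of \<open>F_1\<close> found in the image is carried
  back by the inverse of \<open>\<tau>\<close>.\<close>

lemma clebsch_embedding_and_groetzsch:
  assumes no_comparable: "\<And>u v. u \<in> V \<Longrightarrow> v \<in> V \<Longrightarrow> u \<noteq> v \<Longrightarrow> \<not> E u v \<Longrightarrow> \<exists>w. E u w \<and> \<not> E v w"
    and no_col: "\<not> three_colourable V E"
  obtains \<tau> v0 v1 v2 v3 v4 w0 w1 w2 w3 w4 z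
    where "inj_on \<tau> V" "\<And>x y. x \<in> V \<Longrightarrow> y \<in> V \<Longrightarrow> (\<tau> x, \<tau> y) \<in> parcs clebsch \<longleftrightarrow> E x y"
      "groetzsch_edges E v0 v1 v2 v3 v4 w0 w1 w2 w3 w4 z"
proof -
  \<comment> \<open>A graph without edges is coloured by a constant.\<close>
  obtain u w where "E u w"
    using no_col three_colourableI[of E "\<lambda>_. True" "\<lambda>_. True"] by blast
  then have "\<exists>v0 v1 v2 v3 v4 z. c5z v0 v1 v2 v3 v4 z"
    using exists_c5z[of u w] edge_in no_col by blast
  then have "\<exists>v0 v1 v2 v3 v4 z w2 w3. h8 v0 v1 v2 v3 v4 z w2 w3"
    using c5z_imp_h8[OF no_comparable] by blast
  then have "\<exists>v0 v1 v2 v3 v4 z w2 w3 w4. h9 v0 v1 v2 v3 v4 z w2 w3 w4"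
    using h8_imp_h9 no_col by blast
  then obtain v0 v1 v2 v3 v4 z w2 w3 w4 where h: "h9 v0 v1 v2 v3 v4 z w2 w3 w4"
    by (elim exE)
  obtain \<tau> where inj: "inj_on \<tau> V"
    and adj: "\<And>x y. x \<in> V \<Longrightarrow> y \<in> V \<Longrightarrow> (\<tau> x, \<tau> y) \<in> parcs clebsch \<longleftrightarrow> E x y"
    and K: "{(0, 0, 0, 0), (0, 0, 1, 0), (0, 0, 0, 1), (1, 1, 1, 1), (1, 0, 1, 1), (1, 0, 1, 0), (0, 1, 0, 1), (1, 1, 0, 1), (1, 0, 0, 1)} \<subseteq> \<tau> ` V"
    using h9_imp_clebsch[OF no_comparable h] by blast
  define R where "R p q \<longleftrightarrow> p \<in> \<tau> ` V \<and> q \<in> \<tau> ` V \<and> (p, q) \<in> parcs clebsch" for p q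
  have R: "R (\<tau> x) (\<tau> y)" if "E x y" for x y
    using that edge_in comm adj unfolding R_def by blast
  have R_inv: "E (inv_into V \<tau> p) (inv_into V \<tau> q)" if "R p q" for p q
    using that adj inj unfolding R_def by auto
  have "\<not> three_colourable (\<tau> ` V) R"
  proof
    assume "three_colourable (\<tau> ` V) R"
    then obtain c where c: "\<forall>p \<in> \<tau> ` V. c p < (3 :: nat)" "\<forall>p q. R p q \<longrightarrow> c p \<noteq> c q"
      unfolding three_colourable_def by blast
    have "three_colourable V E"
      unfolding three_colourable_def by (rule exI[of _ "c \<circ> \<tau>"]) (use c R in \<open>unfold o_def, blast\<close>)
    then show False using no_col by blast
  qed
  then obtain v0 v1 v2 v3 v4 w0 w1 w2 w3 w4 z where "groetzsch_edges R v0 v1 v2 v3 v4 w0 w1 w2 w3 w4 z"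
    using clebsch_induced_three_colourable_or_groetzsch[OF K] unfolding R_def by blast
  then have "groetzsch_edges E (inv_into V \<tau> v0) (inv_into V \<tau> v1) (inv_into V \<tau> v2)
    (inv_into V \<tau> v3) (inv_into V \<tau> v4) (inv_into V \<tau> w0) (inv_into V \<tau> w1) (inv_into V \<tau> w2)
    (inv_into V \<tau> w3) (inv_into V \<tau> w4) (inv_into V \<tau> z)"
    unfolding groetzsch_edges_def using R_inv by simp
  then show thesis using that inj adj by blast
qed

lemma groetzsch_edges_embedding:
  assumes g: "groetzsch_edges E v0 v1 v2 v3 v4 w0 w1 w2 w3 w4 z"
  obtains f where "inj_on f (pverts mycielski_groetzsch)" "f ` pverts mycielski_groetzsch \<subseteq> V"
    "\<And>a b. a \<in> pverts mycielski_groetzsch \<Longrightarrow> b \<in> pverts mycielski_groetzsch \<Longrightarrow>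
      E (f a) (f b) \<longleftrightarrow> (a, b) \<in> parcs mycielski_groetzsch"
proof -
  have e: "E v0 v1" "E v1 v2" "E v2 v3" "E v3 v4" "E v4 v0"
    "E w0 v4" "E w0 v1" "E w1 v0" "E w1 v2" "E w2 v1" "E w2 v3" "E w3 v2" "E w3 v4" "E w4 v3" "E w4 v0"
    "E w0 z" "E w1 z" "E w2 z" "E w3 z" "E w4 z"
    using g unfolding groetzsch_edges_def by blast+
  have sym: "E y x" if "E x y" for x y using that comm by blast
  have nsym: "\<not> E y x" if "\<not> E x y" for x y using that comm by blast
  \<comment> \<open>Any two distinct nonadjacent vertices of \<open>F_1\<close> have a common
    neighbour, so \<open>tri\<close> excludes all further edges.\<close>
  have ne: "\<not> E v0 v2" "\<not> E v0 v3" "\<not> E v1 v3" "\<not> E v1 v4" "\<not> E v2 v4"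
    "\<not> E w0 v0" "\<not> E w0 v2" "\<not> E w0 v3" "\<not> E w1 v1" "\<not> E w1 v3" "\<not> E w1 v4" "\<not> E w2 v2" "\<not> E w2 v4" "\<not> E w2 v0"
    "\<not> E w3 v3" "\<not> E w3 v0" "\<not> E w3 v1" "\<not> E w4 v4" "\<not> E w4 v1" "\<not> E w4 v2"
    "\<not> E w0 w1" "\<not> E w0 w2" "\<not> E w0 w3" "\<not> E w0 w4" "\<not> E w1 w2" "\<not> E w1 w3" "\<not> E w1 w4" "\<not> E w2 w3" "\<not> E w2 w4"
    "\<not> E w3 w4" "\<not> E v0 z" "\<not> E v1 z" "\<not> E v2 z" "\<not> E v3 z" "\<not> E v4 z"
    using e by (metis comm tri)+
  let ?H = mycielski_groetzsch
  define f where "f a = (case a of Mv i \<Rightarrow> [v0, v1, v2, v3, v4] ! i | Mw i \<Rightarrow> [w0, w1, w2, w3, w4] ! i | Mz \<Rightarrow> z)" for a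
  have "{..<5 :: nat} = {0, 1, 2, 3, 4}"
    by auto
  then have verts: "pverts ?H = {Mv 0, Mv 1, Mv 2, Mv 3, Mv 4, Mw 0, Mw 1, Mw 2, Mw 3, Mw 4, Mz}"
    by (simp add: mycielski_groetzsch_def Let_def insert_commute)
  have Mv_Mv: "(Mv i, Mv j) \<in> parcs ?H \<longleftrightarrow> i < 5 \<and> j = (i + 1) mod 5 \<or> j < 5 \<and> i = (j + 1) mod 5" for i j
    by (auto simp: mycielski_groetzsch_def Let_def)
  have Mw_Mv: "(Mw i, Mv j) \<in> parcs ?H \<longleftrightarrow> i < 5 \<and> (j = (i + 1) mod 5 \<or> j = (i + 4) mod 5)"
    and Mv_Mw: "(Mv j, Mw i) \<in> parcs ?H \<longleftrightarrow> i < 5 \<and> (j = (i + 1) mod 5 \<or> j = (i + 4) mod 5)" for i j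
    by (auto simp: mycielski_groetzsch_def Let_def)
  have Mw_Mw: "(Mw i, Mw j) \<notin> parcs ?H"
    and Mw_Mz: "(Mw i, Mz) \<in> parcs ?H \<longleftrightarrow> i < 5" "(Mz, Mw i) \<in> parcs ?H \<longleftrightarrow> i < 5"
    and Mv_Mz: "(Mv i, Mz) \<notin> parcs ?H" "(Mz, Mv i) \<notin> parcs ?H" "(Mz, Mz) \<notin> parcs ?H" for i j
    by (auto simp: mycielski_groetzsch_def Let_def)
  note arcs = Mv_Mv Mw_Mv Mv_Mw Mw_Mw Mw_Mz Mv_Mz
  have adj: "E (f a) (f b) \<longleftrightarrow> (a, b) \<in> parcs ?H" if "a \<in> pverts ?H" "b \<in> pverts ?H" for a b
  proof -
    have "\<forall>a \<in> pverts ?H. \<forall>b \<in> pverts ?H. E (f a) (f b) \<longleftrightarrow> (a, b) \<in> parcs ?H"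
      unfolding verts using e e[THEN sym] ne ne[THEN nsym]
      by (simp add: arcs f_def irrefl)
    then show ?thesis using that by blast
  qed
  have "inj_on f (pverts ?H)"
  proof (rule inj_onI)
    fix a b assume ab: "a \<in> pverts ?H" "b \<in> pverts ?H" "f a = f b"
    \<comment> \<open>Distinct vertices of \<open>F_1\<close> have distinct neighbourhoods, so a map
      that preserves adjacency and non-adjacency is injective.\<close>
    have "\<forall>a \<in> pverts ?H. \<forall>b \<in> pverts ?H. (\<forall>x \<in> pverts ?H. (a, x) \<in> parcs ?H \<longleftrightarrow> (b, x) \<in> parcs ?H) \<longrightarrow> a = b"
      unfolding verts by (simp add: arcs)
    moreover have "\<forall>x \<in> pverts ?H. (a, x) \<in> parcs ?H \<longleftrightarrow> (b, x) \<in> parcs ?H"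
      using adj[OF ab(1)] adj[OF ab(2)] ab(3) by simp
    ultimately show "a = b" using ab(1,2) by blast
  qed
  moreover have "f ` pverts ?H \<subseteq> V"
    unfolding verts using e edge_in comm by (simp add: f_def) blast
  ultimately show thesis using adj by (rule that)
qed

end

section \<open>Forbidden induced subgraphs and the theorem\<close>

lemma triangle_induced_copy:
  assumes "pair_graph G" and e: "(a, b) \<in> parcs G" "(b, c) \<in> parcs G" "(a, c) \<in> parcs G"
  shows "has_induced_copy (cycle_graph 3) G"
proof -
  interpret pair_graph G by fact
  note e' = e e[THEN arcs_symmetric]
  have irrefl: "(x, x) \<notin> parcs G" for x using no_loops' by blast
  have verts: "pverts (cycle_graph 3) = {0, 1, 2}"
    by (auto simp: cycle_graph_def)
  let ?f = "\<lambda>i. [a, b, c] ! i"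
  show ?thesis
  proof (rule has_induced_copyI)
    show "inj_on ?f (pverts (cycle_graph 3))"
      unfolding verts using e irrefl by auto
    show "?f ` pverts (cycle_graph 3) \<subseteq> pverts G"
      unfolding verts using e wellformed' by auto
    have "\<forall>i \<in> {0, 1, 2}. \<forall>j \<in> {0, 1, 2}. (?f i, ?f j) \<in> parcs G \<longleftrightarrow> (i, j) \<in> parcs (cycle_graph 3)"
      using e' irrefl by (simp add: cycle_graph_def)
    then show "(?f i, ?f j) \<in> parcs G \<longleftrightarrow> (i, j) \<in> parcs (cycle_graph 3)"
      if "i \<in> pverts (cycle_graph 3)" "j \<in> pverts (cycle_graph 3)" for i j
      using that unfolding verts by blast
    show "pair_wf_digraph (cycle_graph 3)"
      by unfold_locales (auto simp: cycle_graph_def)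
  qed (rule pair_wf_digraph)
qed

lemma p2p4_induced_copy:
  assumes "pair_graph G"
    and e: "(a, b) \<in> parcs G" "(c, d) \<in> parcs G" "(d, e) \<in> parcs G" "(e, f) \<in> parcs G"
    and ne: "(c, e) \<notin> parcs G" "(c, f) \<notin> parcs G" "(d, f) \<notin> parcs G"
      "(a, c) \<notin> parcs G" "(a, d) \<notin> parcs G" "(a, e) \<notin> parcs G" "(a, f) \<notin> parcs G"
      "(b, c) \<notin> parcs G" "(b, d) \<notin> parcs G" "(b, e) \<notin> parcs G" "(b, f) \<notin> parcs G"
  shows "has_induced_copy (disjoint_union_graph (path_graph 2) (path_graph 4)) G"
proof -
  interpret pair_graph G by fact
  let ?H = "disjoint_union_graph (path_graph 2) (path_graph 4)"
  have nsym: "(y, x) \<notin> parcs G" if "(x, y) \<notin> parcs G" for x y using that arcs_symmetric by blast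
  have irrefl: "(x, x) \<notin> parcs G" for x using no_loops' by blast
  note e' = e e[THEN arcs_symmetric]
  note ne' = ne ne[THEN nsym] irrefl
  have "pverts (path_graph 2) = {0, 1}" "pverts (path_graph 4) = {0, 1, 2, 3}"
    by (auto simp: path_graph_def)
  then have verts: "pverts ?H = {Inl 0, Inl 1, Inr 0, Inr 1, Inr 2, Inr 3}"
    by (auto simp: disjoint_union_graph_def)
  have arcs: "(Inl i, Inl j) \<in> parcs ?H \<longleftrightarrow> i < 2 \<and> j < 2 \<and> (j = Suc i \<or> i = Suc j)"
    "(Inr i, Inr j) \<in> parcs ?H \<longleftrightarrow> i < 4 \<and> j < 4 \<and> (j = Suc i \<or> i = Suc j)"
    "(Inl i, Inr j) \<notin> parcs ?H" "(Inr i, Inl j) \<notin> parcs ?H" for i j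
    by (force simp: disjoint_union_graph_def path_graph_def)+
  let ?f = "case_sum (\<lambda>i. [a, b] ! i) (\<lambda>i. [c, d, e, f] ! i)"
  have "\<forall>x \<in> pverts ?H. \<forall>y \<in> pverts ?H. (?f x, ?f y) \<in> parcs G \<longleftrightarrow> (x, y) \<in> parcs ?H"
    unfolding verts using e' ne' by (simp add: arcs)
  then have adj: "(?f x, ?f y) \<in> parcs G \<longleftrightarrow> (x, y) \<in> parcs ?H"
    if "x \<in> pverts ?H" "y \<in> pverts ?H" for x y
    using that by blast
  show ?thesis
  proof (rule has_induced_copyI[where f = ?f, OF _ _ _ _ adj])
    show "inj_on ?f (pverts ?H)"
    proof (rule inj_onI)
      fix x y assume xy: "x \<in> pverts ?H" "y \<in> pverts ?H" "?f x = ?f y"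
      \<comment> \<open>Injectivity again follows because distinct vertices of
        \<open>P_2 \<union> P_4\<close> have distinct neighbourhoods.\<close>
      have "\<forall>x \<in> pverts ?H. \<forall>y \<in> pverts ?H. (\<forall>w \<in> pverts ?H. (x, w) \<in> parcs ?H \<longleftrightarrow> (y, w) \<in> parcs ?H)
        \<longrightarrow> x = y"
        unfolding verts by (simp add: arcs)
      moreover have "\<forall>w \<in> pverts ?H. (x, w) \<in> parcs ?H \<longleftrightarrow> (y, w) \<in> parcs ?H"
        using adj[OF xy(1)] adj[OF xy(2)] xy(3) by simp
      ultimately show "x = y" using xy(1,2) by blast
    qed
    show "?f ` pverts ?H \<subseteq> pverts G"
      unfolding verts using e' wellformed' by auto
    show "pair_wf_digraph ?H"
      by unfold_locales (auto simp: disjoint_union_graph_def path_graph_def)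
  qed (auto intro: pair_wf_digraph)
qed

theorem theorem1p2:
  fixes G :: "'a pair_pre_digraph"
  assumes "pair_graph G"
    and "connected (with_proj G)"
    and "\<not> has_induced_copy (disjoint_union_graph (path_graph 2) (path_graph 4)) G"
    and "\<not> has_induced_copy (cycle_graph 3) G"
  shows "has_comparable_pair G
    \<or> chromatic_number G \<le> 3
    \<or> (has_induced_copy mycielski_groetzsch G \<and> has_induced_copy G clebsch)"
proof -
  interpret pair_graph G by fact
  let ?V = "pverts G" and ?E = "\<lambda>x y. (x, y) \<in> parcs G"
  interpret P: p2p4_c3_free ?V ?E
  proof
    show "x \<in> pverts G" if "(x, y) \<in> parcs G" for x y
      using that wellformed' by blast
    show "(x, y) \<in> parcs G \<longleftrightarrow> (y, x) \<in> parcs G" for x y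
      using arcs_symmetric by blast
    show "(a, c) \<notin> parcs G" if "(a, b) \<in> parcs G" "(b, c) \<in> parcs G" for a b c
      using that triangle_induced_copy[OF assms(1)] assms(4) by blast
  qed (rule notE[OF assms(3) p2p4_induced_copy[OF assms(1)]])
  show ?thesis
  proof (cases "has_comparable_pair G \<or> three_colourable ?V ?E")
    case True
    moreover have "chromatic_number G \<le> 3" if "three_colourable ?V ?E"
    proof -
      have "\<exists>c. proper_colouring G 3 c"
        using that unfolding three_colourable_def proper_colouring_def by auto
      then show ?thesis unfolding chromatic_number_def by (rule Least_le)
    qed
    ultimately show ?thesis by blast
  next
    case False
    have "\<exists>w. ?E u w \<and> \<not> ?E v w" if "u \<in> ?V" "v \<in> ?V" "u \<noteq> v" "\<not> ?E u v" for u v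
      using that False unfolding has_comparable_pair_def neighbourhood_def by blast
    then obtain \<tau> v0 v1 v2 v3 v4 w0 w1 w2 w3 w4 z
      where \<tau>: "inj_on \<tau> ?V" "\<And>x y. x \<in> ?V \<Longrightarrow> y \<in> ?V \<Longrightarrow> (\<tau> x, \<tau> y) \<in> parcs clebsch \<longleftrightarrow> ?E x y"
        and g: "groetzsch_edges ?E v0 v1 v2 v3 v4 w0 w1 w2 w3 w4 z"
      using P.clebsch_embedding_and_groetzsch False by blast
    have wf: "pair_wf_digraph clebsch" "pair_wf_digraph mycielski_groetzsch"
      by unfold_locales (auto simp: clebsch_def mycielski_groetzsch_def Let_def)
    have "has_induced_copy G clebsch"
      by (rule has_induced_copyI[OF wf(1) pair_wf_digraph \<tau>(1) _ \<tau>(2)]) (simp_all add: clebsch_def)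
    moreover obtain f where "inj_on f (pverts mycielski_groetzsch)" "f ` pverts mycielski_groetzsch \<subseteq> ?V"
      "\<And>a b. a \<in> pverts mycielski_groetzsch \<Longrightarrow> b \<in> pverts mycielski_groetzsch \<Longrightarrow>
        ?E (f a) (f b) \<longleftrightarrow> (a, b) \<in> parcs mycielski_groetzsch"
      using P.groetzsch_edges_embedding[OF g] by blast
    then have "has_induced_copy mycielski_groetzsch G"
      by (rule has_induced_copyI[OF pair_wf_digraph wf(2)])
    ultimately show ?thesis by blast
  qed
qed

end
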